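(* Let $\mu^{\mathrm{RC}}_{E,\boldsymbol p,\boldsymbol\lambda}$ be the distribution of the random cluster model specified by a graph $G=(V,E)$ and parameters $\boldsymbol p\in(0,1)^E$ and $\boldsymbol\lambda\in[0,1)^V$, and let $\lambda_{\max}=\max_{v\in V}\lambda_v$. Then $\mu^{\mathrm{RC}}_{E,\boldsymbol p,\boldsymbol\lambda}$ is $2(1-\lambda_{\max})^{-2}$-spectrally independent under all pinnings.
   Context: Graphs are finite, undirected and simple. The random cluster model is the distribution over subsets $S\subseteq E$ with $\mu^{\mathrm{RC}}_{E,\boldsymbol p,\boldsymbol\lambda}(S)=w(S)/\sum_{T\subseteq E}w(T)$, where $$w(S)=\prod_{e\in S}p_e\prod_{f\in E\setminus S}(1-p_f)\prod_{C\in\kappa(V,S)}\Bigl(1+\prod_{j\in C}\lambda_j\Bigr),$$ and $\kappa(V,S)$ is the set of connected components (as vertex sets) of $(V,S)$. For a distribution $\mu$ over $2^U$ ($U$ finite), $\mu(j\mid i)=\Pr_{S\sim\mu}[j\in S\mid i\in S]$ and $\mu(j\mid\overline i)=\Pr_{S\sim\mu}[j\in S\mid i\notin S]$. The influence matrix $\Psi^{\mathrm{inf}}_\mu\in\mathbb R^{U\times U}$ has entries $\Psi^{\mathrm{inf}}_\mu(i,j)=\mu(j\mid i)-\mu(j\mid\overline i)$ if $i\ne j$ and $0<\Pr_{S\sim\mu}[i\in S]<1$, and $0$ otherwise. The distribution $\mu$ is $C$-spectrally independent if $\|\Psi^{\mathrm{inf}}_\mu\|_\infty=\max_{i\in U}\sum_{j\in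 U}|\Psi^{\mathrm{inf}}_\mu(i,j)|\le C$. For $\tau,\Lambda\subseteq U$ let $\mathcal P_{\tau,\Lambda}=\{S\subseteq U: S\cap\Lambda=\tau\cap\Lambda\}$. The distribution $\mu$ is $C$-spectrally independent under all pinnings if for all $\tau,\Lambda\subseteq U$ with $\mu(\mathcal P_{\tau,\Lambda})>0$, the conditional distribution $\mu(\cdot\mid\mathcal P_{\tau,\Lambda})$ projected on $U\setminus\Lambda$ is $C$-spectrally independent. *)

theory Defs
  imports "HOL-Probability.Probability"
begin

definition simple_graph :: "'v set \<Rightarrow> 'v set set \<Rightarrow> bool" where
  "simple_graph V E \<longleftrightarrow> finite V \<and> (\<forall>e\<in>E. e \<subseteq> V \<and> card e = 2)"

definition adj :: "'v set set \<Rightarrow> ('v \<times> 'v) set" where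
  "adj S = {(u, v). {u, v} \<in> S}"

text \<open>Isolated vertices count as components of their own.\<close>

definition components :: "'v set \<Rightarrow> 'v set set \<Rightarrow> 'v set set" where
  "components V S = V // {(u, v) \<in> V \<times> V. (u, v) \<in> (adj S)\<^sup>*}"

definition rc_weight ::
  "'v set \<Rightarrow> 'v set set \<Rightarrow> ('v set \<Rightarrow> real) \<Rightarrow> ('v \<Rightarrow> real) \<Rightarrow> 'v set set \<Rightarrow> real" where
  "rc_weight V E p lam S =
     (\<Prod>e\<in>S. p e) * (\<Prod>f\<in>E - S. 1 - p f) * (\<Prod>C\<in>components V S. 1 + (\<Prod>j\<in>C. lam j))"

text \<open>\<open>embed_pmf\<close> is only meaningful for a function that is nonnegative and sums to one;
  \<open>pmf_random_cluster\<close> below shows that this holds for all parameters considered here.\<close>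

definition random_cluster ::
  "'v set \<Rightarrow> 'v set set \<Rightarrow> ('v set \<Rightarrow> real) \<Rightarrow> ('v \<Rightarrow> real) \<Rightarrow> 'v set set pmf" where
  "random_cluster V E p lam =
     embed_pmf (\<lambda>S. if S \<subseteq> E then rc_weight V E p lam S / (\<Sum>T\<in>Pow E. rc_weight V E p lam T)
                    else 0)"

text \<open>A distribution over the subsets of \<open>U\<close> is a \<open>'a set pmf\<close> supported on \<open>Pow U\<close>.\<close>

definition influence :: "'a set pmf \<Rightarrow> 'a \<Rightarrow> 'a \<Rightarrow> real" where
  "influence \<mu> i j =
     (if i \<noteq> j \<and> 0 < \<P>(S in \<mu>. i \<in> S) \<and> \<P>(S in \<mu>. i \<in> S) < 1
      then \<P>(S in \<mu>. j \<in> S \<bar> i \<in> S) - \<P>(S in \<mu>. j \<in> S \<bar> i \<notin> S)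
      else 0)"

text \<open>The empty matrix has norm \<open>0\<close>. This case occurs when every element of the ground set
  is pinned.\<close>

definition matrix_infnorm :: "'a set \<Rightarrow> ('a \<Rightarrow> 'a \<Rightarrow> real) \<Rightarrow> real" where
  "matrix_infnorm U A = (if U = {} then 0 else Max ((\<lambda>i. \<Sum>j\<in>U. \<bar>A i j\<bar>) ` U))"

definition spectrally_independent :: "'a set \<Rightarrow> 'a set pmf \<Rightarrow> real \<Rightarrow> bool" where
  "spectrally_independent U \<mu> C \<longleftrightarrow> matrix_infnorm U (influence \<mu>) \<le> C"

definition pinning :: "'a set \<Rightarrow> 'a set \<Rightarrow> 'a set \<Rightarrow> 'a set set" where
  "pinning U \<tau> \<Lambda> = {S. S \<subseteq> U \<and> S \<inter> \<Lambda> = \<tau> \<inter> \<Lambda>}"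

definition spectrally_independent_all_pinnings :: "'a set \<Rightarrow> 'a set pmf \<Rightarrow> real \<Rightarrow> bool" where
  "spectrally_independent_all_pinnings U \<mu> C \<longleftrightarrow>
     (\<forall>\<tau> \<Lambda>. \<tau> \<subseteq> U \<longrightarrow> \<Lambda> \<subseteq> U \<longrightarrow> measure_pmf.prob \<mu> (pinning U \<tau> \<Lambda>) > 0 \<longrightarrow>
        spectrally_independent (U - \<Lambda>)
          (map_pmf (\<lambda>S. S \<inter> (U - \<Lambda>)) (cond_pmf \<mu> (pinning U \<tau> \<Lambda>))) C)"

lemma simple_graph_finite_edges:
  assumes "simple_graph V E"
  shows "finite E"
proof -
  have "E \<subseteq> Pow V" "finite V"
    using assms by (auto simp: simple_graph_def)
  then show ?thesis
    by (meson finite_Pow_iff finite_subset)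
qed

lemma rc_weight_pos:
  assumes "simple_graph V E"
    and "\<And>e. e \<in> E \<Longrightarrow> 0 < p e \<and> p e < 1"
    and "\<And>v. v \<in> V \<Longrightarrow> 0 \<le> lam v \<and> lam v < 1"
    and "S \<subseteq> E"
  shows "0 < rc_weight V E p lam S"
proof -
  have "0 < (\<Prod>C\<in>components V S. 1 + (\<Prod>j\<in>C. lam j))"
  proof (rule prod_pos)
    fix C assume "C \<in> components V S"
    then have "C \<subseteq> V"
      by (auto simp: components_def quotient_def)
    then have "0 \<le> (\<Prod>j\<in>C. lam j)"
      using assms(3) by (intro prod_nonneg) auto
    then show "0 < 1 + (\<Prod>j\<in>C. lam j)"
      by linarith
  qed
  moreover have "0 < (\<Prod>e\<in>S. p e)"
    using assms(2,4) by (intro prod_pos) auto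
  moreover have "0 < (\<Prod>f\<in>E - S. 1 - p f)"
    using assms(2) by (intro prod_pos) auto
  ultimately show ?thesis
    by (simp add: rc_weight_def)
qed

lemma pmf_random_cluster:
  assumes "simple_graph V E"
    and "\<And>e. e \<in> E \<Longrightarrow> 0 < p e \<and> p e < 1"
    and "\<And>v. v \<in> V \<Longrightarrow> 0 \<le> lam v \<and> lam v < 1"
  shows "pmf (random_cluster V E p lam) S =
    (if S \<subseteq> E then rc_weight V E p lam S / (\<Sum>T\<in>Pow E. rc_weight V E p lam T) else 0)"
proof -
  let ?Z = "\<Sum>T\<in>Pow E. rc_weight V E p lam T"
  let ?f = "\<lambda>S. if S \<subseteq> E then rc_weight V E p lam S / ?Z else 0"
  have fin: "finite (Pow E)"
    using simple_graph_finite_edges[OF assms(1)] by simp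
  have pos: "0 < rc_weight V E p lam T" if "T \<subseteq> E" for T
    using rc_weight_pos[OF assms that] .
  have Z: "0 < ?Z"
    using fin pos by (intro sum_pos) auto
  have nonneg: "0 \<le> ?f T" for T
    using pos[of T] Z by (auto intro!: divide_nonneg_pos less_imp_le)
  have "(\<integral>\<^sup>+T. ennreal (?f T) \<partial>count_space UNIV) = (\<Sum>T\<in>Pow E. ennreal (?f T))"
    using fin by (intro nn_integral_count_space') auto
  also have "\<dots> = ennreal (\<Sum>T\<in>Pow E. ?f T)"
    using nonneg by (intro sum_ennreal) blast
  also have "(\<Sum>T\<in>Pow E. ?f T) = (\<Sum>T\<in>Pow E. rc_weight V E p lam T / ?Z)"
    by (intro sum.cong) auto
  also have "\<dots> = 1"
    using Z by (simp flip: sum_divide_distrib)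
  finally have "(\<integral>\<^sup>+T. ennreal (?f T) \<partial>count_space UNIV) = 1"
    by simp
  from pmf_embed_pmf[of ?f, OF nonneg this] show ?thesis
    by (simp add: random_cluster_def)
qed

end

(* In the Edwards--Sokal coupling the edges of the random cluster model are independent given
   the spins of a ferromagnetic Ising model with external fields. Pinning an edge amounts to
   setting its parameter to 1 or 0, so no contraction is needed and the graph stays simple. The
   total influence of an edge uv becomes the increase of the expected number of open edges when
   the spins of u and v are forced to agree; its terms are nonnegative by Griffiths' inequality,
   and again by Griffiths it is at most the increase caused by forcing first u and then v to be
   plus. Each of these two increases is bounded by the expected length of the backbone: a source
   at u moves along edges, and at each fresh vertex it survives with probability at most
   L = Max lam. A walk that has visited k vertices crosses at most binomial(k, 2) edges, since the
   graph is simple, so the expected length is at most 1 / (1 - L)^2. *)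

theory Submission
  imports Defs
begin

section \<open>Spins, characters and unnormalised moments\<close>

text \<open>A configuration is encoded by the set \<open>M\<close> of its minus vertices, so
  flipping the spins in \<open>D\<close> is symmetric difference with \<open>D\<close>, and a sum
  over configurations is a sum over \<open>Pow V\<close>.\<close>

definition spin :: "'v \<Rightarrow> 'v set \<Rightarrow> real" where
  "spin v M = (if v \<in> M then -1 else 1)"

definition chi :: "'v set \<Rightarrow> 'v set \<Rightarrow> real" where
  "chi A M = (\<Prod>v\<in>A. spin v M)"

text \<open>Not divided by the total weight: correlation inequalities are stated with products of
  moments, which stay meaningful when a moment is zero.\<close>

definition moment :: "'v set \<Rightarrow> ('v set \<Rightarrow> real) \<Rightarrow> ('v set \<Rightarrow> real) \<Rightarrow> real" where
  "moment V w f = (\<Sum>M\<in>Pow V. w M * f M)"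

lemma spin_square [simp]: "spin v M * spin v M = 1"
  by (simp add: spin_def)

lemma spin_sym_diff: "spin v (sym_diff M D) = spin v M * spin v D"
  by (auto simp: spin_def)

lemma chi_sym_diff: "chi A (sym_diff M D) = chi A M * chi A D"
  by (simp add: chi_def spin_sym_diff prod.distrib)

lemma chi_empty [simp]: "chi {} M = 1"
  by (simp add: chi_def)

lemma chi_singleton [simp]: "chi {v} M = spin v M"
  by (simp add: chi_def)

lemma chi_pair: "u \<noteq> v \<Longrightarrow> chi {u, v} M = spin u M * spin v M"
  by (simp add: chi_def)

lemma chi_cases: "chi A M = 1 \<or> chi A M = -1"
  by (induction A rule: infinite_finite_induct) (auto simp: chi_def spin_def)

lemma chi_square [simp]: "chi A M * chi A M = 1"
  using chi_cases[of A M] by auto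

lemma sum_Pow_sym_diff:
  assumes "D \<subseteq> V"
  shows "(\<Sum>M\<in>Pow V. h (sym_diff D M)) = (\<Sum>M\<in>Pow V. h M)"
  by (rule sum.reindex_bij_witness[where i = "sym_diff D" and j = "sym_diff D"])
    (use assms in \<open>auto simp: Un_Diff Diff_Un intro!: arg_cong[where f = h]\<close>)

text \<open>For nonempty \<open>A\<close>, flipping one vertex of \<open>A\<close> negates the
  character, so the sum equals its own negative and vanishes.\<close>

lemma sum_chi:
  assumes "finite V" "A \<subseteq> V"
  shows "(\<Sum>M\<in>Pow V. chi A M) \<ge> 0"
proof (cases "A = {}")
  case False
  then obtain v where v: "v \<in> A" by auto
  have "finite A" using assms finite_subset by blast
  have c: "chi A {v} = -1"
    using v \<open>finite A\<close> by (simp add: chi_def prod.remove[of A v] spin_def)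
  have "(\<Sum>M\<in>Pow V. chi A M) = (\<Sum>M\<in>Pow V. chi A (sym_diff {v} M))"
    using v assms by (intro sum_Pow_sym_diff[symmetric]) auto
  also have "\<dots> = - (\<Sum>M\<in>Pow V. chi A M)"
    unfolding chi_sym_diff c by (simp add: sum_negf)
  finally show ?thesis by simp
qed (simp add: sum_nonneg)

section \<open>The cone of ferromagnetic functions\<close>

text \<open>The polynomials in the spins with nonnegative coefficients. Building monomials one spin
  at a time lets the main closure properties be proved by induction.\<close>

inductive ferro :: "'v set \<Rightarrow> ('v set \<Rightarrow> real) \<Rightarrow> bool" for V where
  const: "0 \<le> c \<Longrightarrow> ferro V (\<lambda>_. c)"
| spin_mult: "v \<in> V \<Longrightarrow> ferro V f \<Longrightarrow> ferro V (\<lambda>M. spin v M * f M)"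
| add: "ferro V f \<Longrightarrow> ferro V g \<Longrightarrow> ferro V (\<lambda>M. f M + g M)"

lemma ferro_spin: "v \<in> V \<Longrightarrow> ferro V (spin v)"
  using ferro.spin_mult[OF _ ferro.const[of 1 V], of v] by simp

lemma ferro_mult:
  assumes "ferro V f" "ferro V g"
  shows "ferro V (\<lambda>M. f M * g M)"
  using assms(1)
proof induction
  case (const c)
  show ?case using assms(2)
  proof induction
    case (const d)
    then show ?case using \<open>0 \<le> c\<close> ferro.const[of "c * d"] by simp
  next
    case (spin_mult v f)
    then show ?case using ferro.spin_mult[of v V] by (fastforce simp: mult_ac)
  next
    case (add f g)
    then show ?case using ferro.add[of V] by (fastforce simp: distrib_left)
  qed
next
  case (spin_mult v f)
  then show ?case using ferro.spin_mult[of v V] by (fastforce simp: mult_ac)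
next
  case (add f h)
  then show ?case using ferro.add[of V] by (fastforce simp: distrib_right)
qed

lemma ferro_scale: "0 \<le> c \<Longrightarrow> ferro V f \<Longrightarrow> ferro V (\<lambda>M. c * f M)"
  by (intro ferro_mult ferro.const)

lemma ferro_sum: "(\<And>i. i \<in> I \<Longrightarrow> ferro V (f i)) \<Longrightarrow> ferro V (\<lambda>M. \<Sum>i\<in>I. f i M)"
  by (induction I rule: infinite_finite_induct) (auto intro: ferro.intros)

lemma ferro_chi:
  assumes "A \<subseteq> V"
  shows "ferro V (chi A)"
proof -
  have "ferro V (\<lambda>M. \<Prod>v\<in>A. spin v M)"
    using assms
    by (induction A rule: infinite_finite_induct) (auto intro: ferro.const ferro.spin_mult)
  then show ?thesis by (simp add: chi_def[abs_def])
qed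

text \<open>Griffiths' first inequality for the counting measure: expanded into characters, the sum
  has nonnegative coefficients only.\<close>

lemma sum_ferro_nonneg:
  assumes "finite V" "ferro V f"
  shows "(\<Sum>M\<in>Pow V. f M) \<ge> 0"
proof -
  \<comment> \<open>The extra character makes the induction work: multiplying by
    \<open>spin v\<close> toggles \<open>v\<close> in \<open>A\<close>, because the square of a spin
    is 1.\<close>
  have "(\<Sum>M\<in>Pow V. chi A M * f M) \<ge> 0" if "A \<subseteq> V" for A
    using assms(2) that
  proof (induction arbitrary: A)
    case (const c)
    then show ?case
      using sum_chi[OF assms(1)] by (simp flip: sum_distrib_right)
  next
    case (spin_mult v f)
    have "finite A" using spin_mult assms(1) finite_subset by blast
    show ?case
    proof (cases "v \<in> A")
      case True
      then have "chi A M * (spin v M * f M) = chi (A - {v}) M * f M" for M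
        using \<open>finite A\<close> by (simp add: chi_def prod.remove[of A v] mult_ac)
      moreover have "A - {v} \<subseteq> V" using spin_mult by auto
      ultimately show ?thesis using spin_mult.IH by presburger
    next
      case False
      then have "chi A M * (spin v M * f M) = chi (insert v A) M * f M" for M
        using \<open>finite A\<close> by (simp add: chi_def mult_ac)
      moreover have "insert v A \<subseteq> V" using spin_mult by auto
      ultimately show ?thesis using spin_mult.IH by presburger
    qed
  next
    case (add f g)
    then show ?case by (simp add: distrib_left sum.distrib)
  qed
  from this[of "{}"] show ?thesis by simp
qed

text \<open>At \<open>v \<in> D\<close> the spin changes sign under the flip, so the difference for
  \<open>spin v * f\<close> is \<open>spin v\<close> times the sum for \<open>f\<close>, and
  conversely. Hence both claims share one induction.\<close>

lemma ferro_sym_diff: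
  assumes "ferro V f"
  shows "ferro V (\<lambda>M. f M - f (sym_diff M D))" "ferro V (\<lambda>M. f M + f (sym_diff M D))"
proof -
  have "ferro V (\<lambda>M. f M - f (sym_diff M D)) \<and> ferro V (\<lambda>M. f M + f (sym_diff M D))"
    using assms
  proof induction
    case (const c)
    then show ?case using ferro.const[of 0 V] ferro.const[of "c + c" V] by simp
  next
    case (spin_mult v f)
    let ?p = "\<lambda>M. spin v M * (f M + f (sym_diff M D))"
    let ?m = "\<lambda>M. spin v M * (f M - f (sym_diff M D))"
    have "ferro V ?p" "ferro V ?m"
      using spin_mult by (auto intro: ferro.spin_mult)
    then show ?case
      by (cases "v \<in> D") (simp_all add: spin_sym_diff spin_def[of v D] algebra_simps)
  next
    case (add f g)
    then have "ferro V (\<lambda>M. (f M - f (sym_diff M D)) + (g M - g (sym_diff M D)))"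
      "ferro V (\<lambda>M. (f M + f (sym_diff M D)) + (g M + g (sym_diff M D)))"
      by (auto intro: ferro.add)
    then show ?case by (simp add: algebra_simps)
  qed
  then show "ferro V (\<lambda>M. f M - f (sym_diff M D))" "ferro V (\<lambda>M. f M + f (sym_diff M D))"
    by auto
qed

section \<open>Ising weights and Griffiths' inequality\<close>

text \<open>For \<open>0 < a\<close> a factor is a multiple of exp(J chi) with tanh J = b / a. The
  boundary case \<open>b = a\<close> is a hard constraint; it arises from edges with parameter 1 and
  from vertices with \<open>lam v = 0\<close>.\<close>

inductive ising_weight :: "'v set \<Rightarrow> ('v set \<Rightarrow> real) \<Rightarrow> bool" for V where
  one: "ising_weight V (\<lambda>_. 1)"
| factor: "A \<subseteq> V \<Longrightarrow> 0 \<le> b \<Longrightarrow> b \<le> a \<Longrightarrow> ising_weight V w \<Longrightarrow>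
    ising_weight V (\<lambda>M. (a + b * chi A M) * w M)"

lemma ising_weight_ferro: "ising_weight V w \<Longrightarrow> ferro V w"
  by (induction rule: ising_weight.induct)
    (auto intro!: ferro.const ferro_mult ferro.add ferro_scale ferro_chi)

text \<open>For fixed \<open>D\<close> the two copies of \<open>chi A\<close> differ by the sign
  \<open>chi A D\<close>, so a product of two factors is linear in \<open>chi A M\<close>. For
  either sign, \<open>b \<le> a\<close> keeps the constant term nonnegative.\<close>

lemma ising_weight_ferro_sym_diff:
  "ising_weight V w \<Longrightarrow> ferro V (\<lambda>M. w M * w (sym_diff M D))"
proof (induction rule: ising_weight.induct)
  case one
  then show ?case using ferro.const[of 1] by simp
next
  case (factor A b a w)
  let ?f = "\<lambda>M. (a\<^sup>2 + b\<^sup>2 * chi A D) + (a * b * (1 + chi A D)) * chi A M"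
  have "b\<^sup>2 \<le> a\<^sup>2" using factor by (intro power_mono) auto
  then have "0 \<le> a\<^sup>2 + b\<^sup>2 * chi A D" "0 \<le> a * b * (1 + chi A D)"
    using chi_cases[of A D] factor by auto
  then have "ferro V ?f"
    using factor by (intro ferro.add ferro.const ferro_scale ferro_chi) auto
  then have "ferro V (\<lambda>M. ?f M * (w M * w (sym_diff M D)))"
    by (intro ferro_mult factor.IH)
  moreover have "?f M = (a + b * chi A M) * (a + b * chi A (sym_diff M D))" for M
  proof -
    have "b * b * (chi A M * chi A M) = b * b" by simp
    then show ?thesis
      by (simp add: chi_sym_diff algebra_simps power2_eq_square)
  qed
  ultimately show ?case by (simp add: mult_ac)
qed

lemma moment_ferro_nonneg:
  assumes "finite V" "ising_weight V w" "ferro V f"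
  shows "moment V w f \<ge> 0"
  using sum_ferro_nonneg[OF assms(1) ferro_mult[OF ising_weight_ferro[OF assms(2)] assms(3)]]
  by (simp add: moment_def)

text \<open>Ginibre's duplication: for fixed \<open>D\<close> the summand of the duplicated system at
  \<open>(M, sym_diff M D)\<close> lies in the cone \<open>ferro\<close>.\<close>

theorem griffiths:
  assumes V: "finite V" and w: "ising_weight V w" and f: "ferro V f" and g: "ferro V g"
  shows "moment V w f * moment V w g \<le> moment V w (\<lambda>M. f M * g M) * moment V w (\<lambda>_. 1)"
proof -
  have fg: "moment V w (\<lambda>M. f M * g M) * moment V w (\<lambda>_. 1)
      = (\<Sum>M\<in>Pow V. \<Sum>M'\<in>Pow V. w M * w M' * (f M * g M))"
    unfolding moment_def sum_product by (simp add: mult_ac)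
  \<comment> \<open>After this exchange \<open>f\<close> sits on the second copy and
    \<open>g\<close> on the first, so the subtraction leaves the factor \<open>f M - f M'\<close>
    beside \<open>g M\<close>.\<close>
  have "moment V w f * moment V w g = moment V w g * moment V w f"
    by (rule mult.commute)
  also have "\<dots> = (\<Sum>M\<in>Pow V. \<Sum>M'\<in>Pow V. w M * w M' * (f M' * g M))"
    unfolding moment_def sum_product by (simp add: mult_ac)
  finally have "moment V w (\<lambda>M. f M * g M) * moment V w (\<lambda>_. 1) - moment V w f * moment V w g
      = (\<Sum>M\<in>Pow V. \<Sum>M'\<in>Pow V. w M * w M' * (f M - f M') * g M)"
    unfolding fg by (simp add: algebra_simps flip: sum_subtractf)
  also have "\<dots> = (\<Sum>M\<in>Pow V. \<Sum>D\<in>Pow V. w M * w (sym_diff M D) * (f M - f (sym_diff M D)) * g M)"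
    by (intro sum.cong refl sum_Pow_sym_diff[symmetric]) auto
  also have "\<dots> = (\<Sum>D\<in>Pow V. \<Sum>M\<in>Pow V. w M * w (sym_diff M D) * (f M - f (sym_diff M D)) * g M)"
    by (rule sum.swap)
  also have "\<dots> \<ge> 0"
    by (intro sum_nonneg sum_ferro_nonneg V ferro_mult ising_weight_ferro_sym_diff ferro_sym_diff
        w f g)
  finally show ?thesis by simp
qed

section \<open>The Ising marginal of the Edwards-Sokal coupling\<close>

definition agree :: "'v set \<Rightarrow> 'v set \<Rightarrow> real" where
  "agree e M = (if e \<subseteq> M \<or> e \<inter> M = {} then 1 else 0)"

text \<open>The spin marginal of the coupling up to normalisation: closed plus open gives the factor
  of an edge, and a minus vertex has weight \<open>lam v\<close>. The edge set is a parameter so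
  that edges can be removed one at a time.\<close>

definition ising ::
  "'v set \<Rightarrow> ('v set \<Rightarrow> real) \<Rightarrow> ('v \<Rightarrow> real) \<Rightarrow> 'v set set \<Rightarrow> 'v set \<Rightarrow> real" where
  "ising V p lam F M =
     (\<Prod>e\<in>F. 1 - p e + p e * agree e M) * (\<Prod>v\<in>V. if v \<in> M then lam v else 1)"

text \<open>The conditional expectation of the number of open edges given the spins: an edge is open
  with probability \<open>p e\<close> if its ends agree, and closed otherwise.\<close>

definition open_mean :: "('v set \<Rightarrow> real) \<Rightarrow> 'v set set \<Rightarrow> 'v set \<Rightarrow> real" where
  "open_mean p F M = (\<Sum>e\<in>F. p e * agree e M)"

text \<open>This is E[f g] / E[g] - E[f] <= c with denominators cleared. The cleared form also
  covers E[g] = 0, as for a spin without edges and field.\<close>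

definition excess_le ::
  "'v set \<Rightarrow> ('v set \<Rightarrow> real) \<Rightarrow> ('v set \<Rightarrow> real) \<Rightarrow> ('v set \<Rightarrow> real) \<Rightarrow> real \<Rightarrow> bool" where
  "excess_le V w f g c \<longleftrightarrow>
     moment V w (\<lambda>M. f M * g M) * moment V w (\<lambda>_. 1) - moment V w f * moment V w g
       \<le> c * (moment V w g * moment V w (\<lambda>_. 1))"

lemma agree_pair: "u \<noteq> v \<Longrightarrow> agree {u, v} M = (1 + spin u M * spin v M) / 2"
  by (auto simp: agree_def spin_def)

lemma agree_nonneg: "0 \<le> agree e M"
  by (simp add: agree_def)

lemma agree_chi:
  assumes "card e = 2"
  shows "agree e M = (1 + chi e M) / 2"
proof -
  obtain u v where "e = {u, v}" "u \<noteq> v"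
    using assms by (auto simp: card_2_iff)
  then show ?thesis by (simp add: agree_pair chi_pair)
qed

lemma ferro_agree:
  assumes "card e = 2" "e \<subseteq> V"
  shows "ferro V (agree e)"
proof -
  have "ferro V (\<lambda>M. 1 / 2 * (1 + chi e M))"
    using assms by (intro ferro_scale ferro.add ferro.const ferro_chi) auto
  moreover have "agree e = (\<lambda>M. 1 / 2 * (1 + chi e M))"
    using agree_chi[OF assms(1)] by (simp add: fun_eq_iff)
  ultimately show ?thesis by simp
qed

lemma ferro_open_mean:
  assumes "\<And>e. e \<in> F \<Longrightarrow> e \<subseteq> V \<and> card e = 2" "\<And>e. e \<in> F \<Longrightarrow> 0 \<le> p e"
  shows "ferro V (open_mean p F)"
  unfolding open_mean_def[abs_def]
  using assms by (intro ferro_sum ferro_scale ferro_agree) auto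

text \<open>Every factor has the form \<open>a + b * chi A M\<close>. The condition
  \<open>b \<le> a\<close> amounts to \<open>p e \<le> 1\<close> for an edge and to
  \<open>0 \<le> lam v\<close> for a vertex.\<close>

lemma ising_weight_ising:
  assumes "\<And>e. e \<in> F \<Longrightarrow> e \<subseteq> V \<and> card e = 2"
    and "\<And>e. e \<in> F \<Longrightarrow> 0 \<le> p e \<and> p e \<le> 1"
    and "\<And>v. v \<in> V \<Longrightarrow> 0 \<le> lam v \<and> lam v \<le> 1"
  shows "ising_weight V (ising V p lam F)"
proof -
  have field: "ising_weight V (\<lambda>M. \<Prod>v\<in>A. if v \<in> M then lam v else 1)" if "A \<subseteq> V" for A
    using that
  proof (induction A rule: infinite_finite_induct)
    case (insert v A)
    then have "ising_weight V (\<lambda>M. ((1 + lam v) / 2 + (1 - lam v) / 2 * chi {v} M) *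
        (\<Prod>v\<in>A. if v \<in> M then lam v else 1))"
      using assms(3) by (intro ising_weight.factor) auto
    moreover have "(1 + lam v) / 2 + (1 - lam v) / 2 * chi {v} M = (if v \<in> M then lam v else 1)"
      for M
      by (simp add: spin_def field_simps)
    ultimately show ?case using insert by simp
  qed (simp_all add: ising_weight.one)
  have "ising_weight V (\<lambda>M. (\<Prod>e\<in>F. 1 - p e + p e * agree e M) *
      (\<Prod>v\<in>V. if v \<in> M then lam v else 1))"
    using assms(1,2)
  proof (induction F rule: infinite_finite_induct)
    case (insert e F)
    then have w: "ising_weight V (\<lambda>M. ((1 - p e / 2) + p e / 2 * chi e M) *
        ((\<Prod>e\<in>F. 1 - p e + p e * agree e M) * (\<Prod>v\<in>V. if v \<in> M then lam v else 1)))"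
      by (intro ising_weight.factor) auto
    have eq: "(1 - p e / 2) + p e / 2 * chi e M = 1 - p e + p e * agree e M" for M
      using insert by (simp add: agree_chi field_simps)
    show ?case using w[unfolded eq] insert by (simp add: mult.assoc)
  qed (simp_all add: field)
  then show ?thesis by (simp add: ising_def[abs_def])
qed

lemma moment_one_pos:
  assumes "finite V" "\<And>M. 0 \<le> w M" "0 < w {}"
  shows "0 < moment V w (\<lambda>_. 1)"
  unfolding moment_def
  using assms by (intro sum_pos2[where i = "{}"]) auto

lemma ising_nonneg:
  assumes "\<And>e. e \<in> F \<Longrightarrow> 0 \<le> p e \<and> p e \<le> 1" "\<And>v. v \<in> V \<Longrightarrow> 0 \<le> lam v"
  shows "0 \<le> ising V p lam F M"
  unfolding ising_def
  using assms by (intro mult_nonneg_nonneg prod_nonneg add_nonneg_nonneg) (auto simp: agree_nonneg)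

lemma ising_empty: "ising V p lam F {} = 1"
  by (simp add: ising_def agree_def)

lemma ising_moment_pos:
  assumes "finite V" "\<And>e. e \<in> F \<Longrightarrow> 0 \<le> p e \<and> p e \<le> 1" "\<And>v. v \<in> V \<Longrightarrow> 0 \<le> lam v"
  shows "0 < moment V (ising V p lam F) (\<lambda>_. 1)"
  using assms by (intro moment_one_pos ising_nonneg) (auto simp: ising_empty)

lemma ising_insert:
  assumes "finite F" "{u, v} \<notin> F" "u \<noteq> v"
  shows "ising V p lam (insert {u, v} F) M =
    ((1 - p {u, v} / 2) + p {u, v} / 2 * (spin u M * spin v M)) * ising V p lam F M"
  using assms by (simp add: ising_def agree_pair field_simps)

lemma ising_field:
  assumes "finite V" "v \<in> V"
  shows "ising V p lam F M =
    ((1 + lam v) / 2 + (1 - lam v) / 2 * spin v M) * ising V p (lam(v := 1)) F M"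
proof -
  have "(\<Prod>x\<in>V - {v}. if x \<in> M then (lam(v := 1)) x else 1) =
      (\<Prod>x\<in>V - {v}. if x \<in> M then lam x else 1)"
    by (intro prod.cong) auto
  then show ?thesis
    using assms by (simp add: ising_def prod.remove[of V v] spin_def flip: add_divide_distrib)
qed

section \<open>How an edge or a field changes the excess\<close>

lemma moment_add: "moment V w (\<lambda>M. f M + g M) = moment V w f + moment V w g"
  by (simp add: moment_def algebra_simps sum.distrib)

lemma moment_cmult: "moment V w (\<lambda>M. c * f M) = c * moment V w f"
  by (simp add: moment_def sum_distrib_left mult_ac)

lemma moment_weight: "moment V (\<lambda>M. h M * w M) f = moment V w (\<lambda>M. h M * f M)"
  by (simp add: moment_def mult_ac)

text \<open>The backbone step: a source at \<open>u\<close> either stays at \<open>u\<close> or moves along the edge, and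
  moving costs at most one.\<close>

lemma edge_step_real:
  fixes a b c c1 c2 Z x y z n nx ny nz :: real
  assumes ab: "0 \<le> b" "b \<le> a" and Z: "0 < Z" and pos: "0 \<le> x" "0 \<le> y" "0 \<le> z"
    and c1: "nx * Z - n * x \<le> c1 * (x * Z)" "c1 \<le> c"
    and c2: "ny * Z - n * y \<le> c2 * (y * Z)" "c2 + 1 \<le> c"
    and nz: "n * z \<le> nz * Z"
  shows "(a * nx + b * ny + b * (x + y)) * (a * Z + b * z)
      - (a * n + b * nz + b * (Z + z)) * (a * x + b * y)
    \<le> c * ((a * x + b * y) * (a * Z + b * z))" (is "?l \<le> ?r")
proof -
  \<comment> \<open>\<open>Z\<close> and \<open>n\<close> stand for the moments of 1 and
    \<open>f\<close>; \<open>x\<close>, \<open>y\<close>, \<open>z\<close> for those of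
    \<open>spin u\<close>, \<open>spin v\<close> and their product; \<open>nx\<close>,
    \<open>ny\<close>, \<open>nz\<close> for the latter three with the extra factor
    \<open>f\<close>.\<close>
  let ?W = "a * Z + b * z"
  have a: "0 \<le> a" using ab by simp
  have W: "0 \<le> ?W" using ab a Z pos by simp
  have xZ: "0 \<le> x * Z" and yZ: "0 \<le> y * Z" using Z pos by auto
  have "nx * Z - n * x \<le> c * (x * Z)"
    using c1 mult_right_mono[OF c1(2) xZ] by linarith
  moreover have "ny * Z - n * y \<le> (c - 1) * (y * Z)"
    using c2 mult_right_mono[OF _ yZ, of c2 "c - 1"] by linarith
  ultimately have "a * (nx * Z - n * x) + b * (ny * Z - n * y)
      \<le> a * (c * (x * Z)) + b * ((c - 1) * (y * Z))"
    using a ab by (intro add_mono mult_left_mono)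
  then have 1: "?W * (a * (nx * Z - n * x) + b * (ny * Z - n * y))
      \<le> ?W * (a * (c * (x * Z)) + b * ((c - 1) * (y * Z)))"
    using W by (rule mult_left_mono)
  have 2: "0 \<le> b * (nz * Z - n * z) * (a * x + b * y)"
    using ab a pos nz by (intro mult_nonneg_nonneg add_nonneg_nonneg) auto
  \<comment> \<open>The edge's own share of the open mean leaves this term. Its bound
    \<open>?W * y\<close> is the unit that lifts \<open>c - 1\<close> to \<open>c\<close> in the
    part with factor \<open>b\<close>.\<close>
  have "(a - b) * (y * Z - x * z) \<le> (a - b) * (y * Z)"
    using ab pos by (intro mult_left_mono) auto
  also have "\<dots> \<le> a * (y * Z)"
    using ab yZ by (intro mult_right_mono) auto
  also have "\<dots> \<le> ?W * y"
    using ab pos by (simp add: algebra_simps)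
  finally have 3: "(Z * b) * ((a - b) * (y * Z - x * z)) \<le> (Z * b) * (?W * y)"
    using ab Z by (intro mult_left_mono) auto
  have "Z * ?l = ?W * (a * (nx * Z - n * x) + b * (ny * Z - n * y))
      - b * (nz * Z - n * z) * (a * x + b * y) + (Z * b) * ((a - b) * (y * Z - x * z))"
    by algebra
  also have "\<dots> \<le> ?W * (a * (c * (x * Z)) + b * ((c - 1) * (y * Z))) + (Z * b) * (?W * y)"
    using 1 2 3 by linarith
  also have "\<dots> = Z * ?r"
    by algebra
  finally show ?thesis using Z by simp
qed

text \<open>Since \<open>spin u\<close> times \<open>spin u * spin v\<close> is
  \<open>spin v\<close>, the new edge turns the moment of \<open>spin u\<close> into a mixture: the
  source stays at \<open>u\<close> with weight \<open>a\<close> and moves to \<open>v\<close> with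
  weight \<open>b\<close>.\<close>

lemma excess_edge_step:
  assumes V: "finite V" "u \<in> V" "v \<in> V" "u \<noteq> v"
    and w: "ising_weight V w" "0 < moment V w (\<lambda>_. 1)" and f: "ferro V f"
    and ab: "0 \<le> b" "b \<le> a" "a + b = 1"
    and u: "excess_le V w f (spin u) c1" "c1 \<le> c"
    and v: "excess_le V w f (spin v) c2" "c2 + 1 \<le> c"
  shows "excess_le V (\<lambda>M. (a + b * (spin u M * spin v M)) * w M)
    (\<lambda>M. f M + b * (1 + spin u M * spin v M)) (spin u) c"
proof -
  let ?m = "moment V w"
  let ?h = "\<lambda>M. a + b * (spin u M * spin v M)"
  let ?uv = "\<lambda>M. spin u M * spin v M"
  note fs = ferro_spin[OF V(2)] ferro_spin[OF V(3)]
  have "(a * ?m (\<lambda>M. f M * spin u M) + b * ?m (\<lambda>M. f M * spin v M)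
        + b * (?m (spin u) + ?m (spin v))) * (a * ?m (\<lambda>_. 1) + b * ?m ?uv)
      - (a * ?m f + b * ?m (\<lambda>M. f M * ?uv M) + b * (?m (\<lambda>_. 1) + ?m ?uv))
        * (a * ?m (spin u) + b * ?m (spin v))
    \<le> c * ((a * ?m (spin u) + b * ?m (spin v)) * (a * ?m (\<lambda>_. 1) + b * ?m ?uv))"
    using u v unfolding excess_le_def
    by (intro edge_step_real ab w griffiths V f moment_ferro_nonneg fs ferro_mult)
  moreover have "?m (\<lambda>M. ?h M * ((f M + b * (1 + ?uv M)) * spin u M)) =
      a * ?m (\<lambda>M. f M * spin u M) + b * ?m (\<lambda>M. f M * spin v M) + b * (?m (spin u) + ?m (spin v))"
  proof -
    \<comment> \<open>Squares of spins are 1, so the edge factor acts on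
      \<open>1 + spin u M * spin v M\<close> as the scalar \<open>a + b\<close>.\<close>
    have "?h M * ((f M + b * (1 + ?uv M)) * spin u M)
        = a * (f M * spin u M) + b * (f M * spin v M) + b * (a + b) * (spin u M + spin v M)" for M
      by (cases "u \<in> M"; cases "v \<in> M") (simp_all add: spin_def algebra_simps)
    then show ?thesis using ab by (simp add: moment_add moment_cmult)
  qed
  moreover have "?m (\<lambda>M. ?h M * (f M + b * (1 + ?uv M))) =
      a * ?m f + b * ?m (\<lambda>M. f M * ?uv M) + b * (?m (\<lambda>_. 1) + ?m ?uv)"
  proof -
    have "?h M * (f M + b * (1 + ?uv M))
        = a * f M + b * (f M * ?uv M) + b * (a + b) * (1 + ?uv M)" for M
      by (cases "u \<in> M"; cases "v \<in> M") (simp_all add: spin_def algebra_simps)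
    then show ?thesis using ab by (simp add: moment_add moment_cmult)
  qed
  moreover have "?m (\<lambda>M. ?h M * spin u M) = a * ?m (spin u) + b * ?m (spin v)"
  proof -
    have "?h M * spin u M = a * spin u M + b * spin v M" for M
      by (cases "u \<in> M") (simp_all add: spin_def algebra_simps)
    then show ?thesis by (simp add: moment_add moment_cmult)
  qed
  moreover have "?m (\<lambda>M. ?h M * 1) = a * ?m (\<lambda>_. 1) + b * ?m ?uv"
    using moment_add[of V w "\<lambda>M. a * 1" "\<lambda>M. b * ?uv M"] moment_cmult[of V w a "\<lambda>_. 1"]
    by (simp add: moment_cmult)
  ultimately show ?thesis
    unfolding excess_le_def moment_weight by presburger
qed

text \<open>The cross terms cancel: the numerator of the excess is multiplied by exactly
  \<open>a\<^sup>2 - b\<^sup>2 = l\<close>, while the denominator \<open>x * Z\<close> grows by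
  \<open>a * b * (x - Z)\<^sup>2\<close>. So \<open>l\<close> is the survival factor of the backbone
  at a vertex with field \<open>l\<close>.\<close>

lemma field_step_real:
  fixes l a b c Z x n nx :: real
  assumes l: "0 \<le> l" "l \<le> 1" and a: "a = (1 + l) / 2" and b: "b = (1 - l) / 2"
    and c: "0 \<le> c" and Z: "0 \<le> Z" and x: "0 \<le> x" and P: "nx * Z - n * x \<le> c * (x * Z)"
  shows "(a * nx + b * n) * (a * Z + b * x) - (a * n + b * nx) * (a * x + b * Z)
    \<le> l * c * ((a * x + b * Z) * (a * Z + b * x))"
proof -
  have ab: "a\<^sup>2 - b\<^sup>2 = l" "a + b = 1" by (auto simp: a b power2_eq_square field_simps)
  have "(a * nx + b * n) * (a * Z + b * x) - (a * n + b * nx) * (a * x + b * Z)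
      = (a\<^sup>2 - b\<^sup>2) * (nx * Z - n * x)"
    by algebra
  also have "\<dots> \<le> l * (c * (x * Z))"
    unfolding ab using l P by (intro mult_left_mono)
  also have "x * Z \<le> (a * x + b * Z) * (a * Z + b * x)"
  proof -
    have "(a * x + b * Z) * (a * Z + b * x) = (a + b)\<^sup>2 * (x * Z) + a * b * (x - Z)\<^sup>2"
      by algebra
    moreover have "0 \<le> a * b * (x - Z)\<^sup>2" using l by (simp add: a b)
    ultimately show ?thesis unfolding ab by simp
  qed
  then have "l * (c * (x * Z)) \<le> l * (c * ((a * x + b * Z) * (a * Z + b * x)))"
    using l c by (intro mult_left_mono)
  finally show ?thesis by (simp add: mult_ac)
qed

lemma excess_field_step:
  assumes V: "finite V" "v \<in> V" and w: "ising_weight V w"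
    and l: "0 \<le> l" "l \<le> 1" and c: "0 \<le> c" "excess_le V w f (spin v) c"
  shows "excess_le V (\<lambda>M. ((1 + l) / 2 + (1 - l) / 2 * spin v M) * w M) f (spin v) (l * c)"
proof -
  let ?m = "moment V w"
  define a where "a = (1 + l) / 2"
  define b where "b = (1 - l) / 2"
  let ?h = "\<lambda>M. a + b * spin v M"
  have "?m (\<lambda>M. ?h M * (f M * spin v M)) = a * ?m (\<lambda>M. f M * spin v M) + b * ?m f"
    "?m (\<lambda>M. ?h M * f M) = a * ?m f + b * ?m (\<lambda>M. f M * spin v M)"
    "?m (\<lambda>M. ?h M * spin v M) = a * ?m (spin v) + b * ?m (\<lambda>_. 1)"
    "?m (\<lambda>M. ?h M * 1) = a * ?m (\<lambda>_. 1) + b * ?m (spin v)"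
    by (simp_all add: algebra_simps flip: moment_add moment_cmult)
  moreover have "0 \<le> ?m (\<lambda>_. 1)" "0 \<le> ?m (spin v)"
    using V w by (auto intro!: moment_ferro_nonneg ferro_spin ferro.const)
  ultimately show ?thesis
    using field_step_real[OF l a_def b_def c(1), of "?m (\<lambda>_. 1)" "?m (spin v)"] c(2)
    unfolding excess_le_def moment_weight a_def[symmetric] b_def[symmetric] by presburger
qed

lemma excess_le_mono:
  assumes "finite V" "ising_weight V w" "ferro V g" "excess_le V w f g c" "c \<le> d"
  shows "excess_le V w f g d"
proof -
  have "0 \<le> moment V w g * moment V w (\<lambda>_. 1)"
    using assms by (intro mult_nonneg_nonneg moment_ferro_nonneg ferro.const) auto
  from mult_right_mono[OF assms(5) this] show ?thesis
    using assms(4) unfolding excess_le_def by linarith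
qed

section \<open>The backbone bound\<close>

lemma moment_spin_eq_0:
  assumes "u \<in> V" "\<And>M. h (sym_diff {u} M) = h M"
  shows "(\<Sum>M\<in>Pow V. h M * spin u M) = 0"
proof -
  have "(\<Sum>M\<in>Pow V. h M * spin u M) =
      (\<Sum>M\<in>Pow V. h (sym_diff {u} M) * spin u (sym_diff {u} M))"
    using assms(1) by (intro sum_Pow_sym_diff[symmetric]) auto
  also have "\<dots> = - (\<Sum>M\<in>Pow V. h M * spin u M)"
    unfolding assms(2) spin_sym_diff by (simp add: spin_def[of u "{u}"] sum_negf)
  finally show ?thesis by simp
qed

lemma agree_flip: "u \<notin> e \<Longrightarrow> agree e (sym_diff {u} M) = agree e M"
  unfolding agree_def by (rule if_cong) auto

text \<open>The end of the backbone: with neither edge nor field at \<open>u\<close>, the weight and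
  the open mean are invariant under the flip at \<open>u\<close>, so both sides of the inequality
  vanish and every \<open>c\<close> works.\<close>

lemma excess_isolated:
  assumes "u \<in> V" "lam u = 1" "\<And>e. e \<in> F \<Longrightarrow> u \<notin> e"
  shows "excess_le V (ising V p lam F) (open_mean p F) (spin u) c"
proof -
  have "ising V p lam F (sym_diff {u} M) = ising V p lam F M"
    "open_mean p F (sym_diff {u} M) = open_mean p F M" for M
    unfolding ising_def open_mean_def using assms
    by (auto simp: agree_flip intro!: arg_cong2[where f = "(*)"] prod.cong sum.cong)
  then have "moment V (ising V p lam F) (\<lambda>M. open_mean p F M * spin u M) = 0"
    "moment V (ising V p lam F) (spin u) = 0"
    unfolding moment_def mult.assoc[symmetric]
    by (intro moment_spin_eq_0[OF assms(1)]; simp)+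
  then show ?thesis by (simp add: excess_le_def)
qed

text \<open>\<open>B\<close> is the set of vertices visited by the backbone; their external fields have been
  removed. An edge inside \<open>B\<close> is crossed at most once, and a fresh vertex is left
  again only with probability at most \<open>L\<close>.\<close>

lemma excess_visited:
  fixes L :: real
  assumes V: "finite V" and L: "0 \<le> L" "L < 1"
    and F: "finite F" "\<And>e. e \<in> F \<Longrightarrow> e \<subseteq> V \<and> card e = 2"
    and p: "\<And>e. e \<in> F \<Longrightarrow> 0 \<le> p e \<and> p e \<le> 1"
    and B: "B \<subseteq> V" "u \<in> B" "\<And>v. v \<in> B \<Longrightarrow> lam v = 1"
    and lam: "\<And>v. v \<in> V - B \<Longrightarrow> 0 \<le> lam v \<and> lam v \<le> L"
  shows "excess_le V (ising V p lam F) (open_mean p F) (spin u)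
    (card {e\<in>F. e \<subseteq> B} + 1 / (1 - L)\<^sup>2 + card B / (1 - L))"
  using F p B lam
\<comment> \<open>Each step deletes an edge at the source and may move the source to a fresh vertex,
  which enlarges \<open>B\<close> and resets a field; hence all of these vary in the
  induction.\<close>
proof (induction "card F" arbitrary: F B u lam)
  case 0
  then show ?case by (intro excess_isolated) auto
next
  case (Suc n)
  show ?case
  proof (cases "\<exists>e\<in>F. u \<in> e")
    case False
    then show ?thesis using Suc.prems by (intro excess_isolated) auto
  next
    case True
    then obtain e where e: "e \<in> F" "u \<in> e" by auto
    with Suc.prems(2) obtain v where v: "e = {u, v}" "u \<noteq> v" "v \<in> V"
      by (auto simp: card_2_iff)
    have u: "u \<in> V" using Suc.prems by auto
    define G where "G = F - {e}"
    have G: "finite G" "e \<notin> G" "F = insert {u, v} G" "n = card G"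
      "\<And>e. e \<in> G \<Longrightarrow> e \<subseteq> V \<and> card e = 2" "\<And>e. e \<in> G \<Longrightarrow> 0 \<le> p e \<and> p e \<le> 1"
      using Suc.hyps(2) Suc.prems e v by (auto simp: G_def)
    have pe: "0 \<le> p e" "p e \<le> 1" using Suc.prems e by auto
    have finB: "finite B" using Suc.prems(4) V finite_subset by blast
    have lam01: "0 \<le> lam x \<and> lam x \<le> 1" if "x \<in> V" for x
      using Suc.prems(6)[of x] Suc.prems(7)[of x] that L by (cases "x \<in> B") auto
    have wt: "ising_weight V (ising V p lam G)"
      using G lam01 by (intro ising_weight_ising) auto
    let ?q = "1 / (1 - L)"
    let ?c = "\<lambda>F B. card {e\<in>F. e \<subseteq> B} + 1 / (1 - L)\<^sup>2 + card B / (1 - L)"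
    have q: "L * ?q = ?q - 1" "1 \<le> ?q" "?q\<^sup>2 = 1 / (1 - L)\<^sup>2"
      using L by (simp_all add: field_simps power_one_over)
    \<comment> \<open>If \<open>v\<close> was visited before, deleting the edge lowers the count of
      edges inside \<open>B\<close> by one, and this pays for crossing it.\<close>
    have "{e\<in>F. e \<subseteq> B} = (if v \<in> B then insert e {e\<in>G. e \<subseteq> B} else {e\<in>G. e \<subseteq> B})"
      using e v G Suc.prems by auto
    moreover have "finite {e\<in>G. e \<subseteq> B}" "e \<notin> {e\<in>G. e \<subseteq> B}"
      using G by auto
    ultimately have cF: "?c F B = ?c G B + (if v \<in> B then 1 else 0)"
      by simp
    have 1: "excess_le V (ising V p lam G) (open_mean p G) (spin u) (?c G B)"
      using Suc.hyps(1)[OF G(4,1,5,6)] Suc.prems by auto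
    have 2: "excess_le V (ising V p lam G) (open_mean p G) (spin v) (?c F B - 1)"
    proof (cases "v \<in> B")
      case True
      then have "excess_le V (ising V p lam G) (open_mean p G) (spin v) (?c G B)"
        using Suc.hyps(1)[OF G(4,1,5,6)] Suc.prems by auto
      then show ?thesis using cF True by (simp add: add.assoc)
    next
      case False
      let ?lam = "lam(v := 1)" and ?B = "insert v B"
      have "excess_le V (ising V p ?lam G) (open_mean p G) (spin v) (?c G ?B)"
        using Suc.prems v by (intro Suc.hyps(1)[OF G(4,1,5,6)]) auto
      moreover have "ising_weight V (ising V p ?lam G)"
        using G lam01 by (intro ising_weight_ising) auto
      moreover have "ising V p lam G =
          (\<lambda>M. ((1 + lam v) / 2 + (1 - lam v) / 2 * spin v M) * ising V p ?lam G M)"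
        using ising_field[OF V v(3)] by blast
      ultimately have "excess_le V (ising V p lam G) (open_mean p G) (spin v) (lam v * ?c G ?B)"
        using excess_field_step[OF V v(3), of "ising V p ?lam G" "lam v" "?c G ?B"] lam01[OF v(3)] L
        by simp
      moreover have "lam v * ?c G ?B \<le> ?c F B - 1"
      proof -
        \<comment> \<open>The edges that become internal join \<open>v\<close> to \<open>B\<close>.
          The edge to \<open>u\<close> has been deleted and the graph is simple, so there are at
          most \<open>card B - 1\<close> of them.\<close>
        have "{e\<in>G. e \<subseteq> ?B} \<subseteq> {e\<in>G. e \<subseteq> B} \<union> (\<lambda>x. {x, v}) ` (B - {u})"
        proof
          fix d assume d: "d \<in> {e\<in>G. e \<subseteq> ?B}"
          then have "card d = 2" using G by auto
          then obtain x y where xy: "d = {x, y}" "x \<noteq> y" by (auto simp: card_2_iff)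
          show "d \<in> {e\<in>G. e \<subseteq> B} \<union> (\<lambda>x. {x, v}) ` (B - {u})"
          proof (cases "v \<in> d")
            case True
            then obtain z where z: "d = {z, v}" "z \<noteq> v"
              using xy by (metis doubleton_eq_iff insertE singletonD)
            then have "z \<noteq> u" "z \<in> B" using d G v by auto
            then show ?thesis using z by auto
          qed (use d in auto)
        qed
        then have "card {e\<in>G. e \<subseteq> ?B} \<le> card ({e\<in>G. e \<subseteq> B} \<union> (\<lambda>x. {x, v}) ` (B - {u}))"
          using G finB by (intro card_mono) auto
        also have "\<dots> \<le> card {e\<in>G. e \<subseteq> B} + card (B - {u})"
          using finB card_Un_le card_image_le by (meson add_left_mono finite_Diff order_trans)
        finally have "card {e\<in>G. e \<subseteq> ?B} \<le> card {e\<in>G. e \<subseteq> B} + (card B - 1)"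
          using Suc.prems(5) by simp
        moreover have "0 < card B"
          using finB Suc.prems(5) by (auto simp: card_gt_0_iff)
        ultimately have "real (card {e\<in>G. e \<subseteq> ?B}) \<le> card {e\<in>G. e \<subseteq> B} + (real (card B) - 1)"
          by linarith
        moreover have "real (card ?B) / (1 - L) = (card B + 1) * ?q" using finB False by simp
        ultimately have cB: "?c G ?B \<le> card {e\<in>G. e \<subseteq> B} + (real (card B) - 1) + ?q\<^sup>2 + (card B + 1) * ?q"
          unfolding q(3) by linarith
        \<comment> \<open>Because \<open>L * ?q = ?q - 1\<close>, the factor \<open>L\<close> turns
          \<open>?q\<^sup>2 + (card B + 1) * ?q\<close> into \<open>?q\<^sup>2 + card B * ?q\<close>
          minus \<open>card B + 1\<close>. This saving pays for the new internal edges and for the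
          crossing.\<close>
        have "lam v * ?c G ?B \<le> L * ?c G ?B"
          using Suc.prems(7)[of v] v False L by (intro mult_right_mono) auto
        also have "\<dots> \<le> L * (card {e\<in>G. e \<subseteq> B} + (real (card B) - 1) + ?q\<^sup>2 + (card B + 1) * ?q)"
          using cB L by (intro mult_left_mono) auto
        also have "\<dots> = L * card {e\<in>G. e \<subseteq> B} + L * (real (card B) - 1) + (L * ?q) * ?q
            + (card B + 1) * (L * ?q)"
          by (simp add: algebra_simps power2_eq_square)
        also have "\<dots> = L * card {e\<in>G. e \<subseteq> B} + L * (real (card B) - 1) + ?q\<^sup>2 - 1
            + card B * ?q - card B"
          unfolding q(1) by (simp add: algebra_simps power2_eq_square add_divide_distrib)
        also have "\<dots> \<le> card {e\<in>G. e \<subseteq> B} + (real (card B) - 1) + ?q\<^sup>2 - 1 + card B * ?q - card B"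
        proof -
          have "L * x \<le> x" if "0 \<le> x" for x :: real
            using that L by (simp add: mult_left_le_one_le)
          moreover have "0 \<le> real (card B) - 1"
            using finB Suc.prems(5) by (auto simp: card_gt_0_iff Suc_le_eq)
          ultimately show ?thesis by (intro add_mono diff_mono) auto
        qed
        also have "\<dots> \<le> ?c F B - 1"
          using cF False q by simp
        finally show ?thesis .
      qed
      ultimately show ?thesis
        using excess_le_mono[OF V wt ferro_spin[OF v(3)]] by blast
    qed
    have "excess_le V (\<lambda>M. ((1 - p e / 2) + p e / 2 * (spin u M * spin v M)) * ising V p lam G M)
        (\<lambda>M. open_mean p G M + p e / 2 * (1 + spin u M * spin v M)) (spin u) (?c F B)"
      using 1 2 V wt G u v pe lam01 cF
      by (intro excess_edge_step[where ?c1.0 = "?c G B" and ?c2.0 = "?c F B - 1"]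
          ising_moment_pos ferro_open_mean) auto
    moreover have "ising V p lam F =
        (\<lambda>M. ((1 - p e / 2) + p e / 2 * (spin u M * spin v M)) * ising V p lam G M)"
      using ising_insert[of G u v V p lam] G v by auto
    moreover have "open_mean p F = (\<lambda>M. open_mean p G M + p e / 2 * (1 + spin u M * spin v M))"
      using G v by (auto simp: open_mean_def agree_pair)
    ultimately show ?thesis by simp
  qed
qed

text \<open>The backbone starts with only \<open>u\<close> visited, where no edge is internal.
  Restoring the field at \<open>u\<close> costs a factor at most \<open>L\<close>, and L (q^2 + q) =
  q^2 - 1 for q = 1 / (1 - L).\<close>

lemma excess_vertex:
  fixes L :: real
  assumes V: "finite V" and L: "0 \<le> L" "L < 1"
    and F: "finite F" "\<And>e. e \<in> F \<Longrightarrow> e \<subseteq> V \<and> card e = 2"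
    and p: "\<And>e. e \<in> F \<Longrightarrow> 0 \<le> p e \<and> p e \<le> 1"
    and lam: "\<And>v. v \<in> V \<Longrightarrow> 0 \<le> lam v \<and> lam v \<le> L" and u: "u \<in> V"
  shows "excess_le V (ising V p lam F) (open_mean p F) (spin u) (1 / (1 - L)\<^sup>2)"
proof -
  let ?lam = "lam(u := 1)" and ?q = "1 / (1 - L)"
  have "{e\<in>F. e \<subseteq> {u}} = {}"
    using F(2) by (force simp: subset_singleton_iff)
  moreover have "excess_le V (ising V p ?lam F) (open_mean p F) (spin u)
      (card {e\<in>F. e \<subseteq> {u}} + 1 / (1 - L)\<^sup>2 + card {u} / (1 - L))"
    using u lam by (intro excess_visited V L F p) auto
  ultimately have "excess_le V (ising V p ?lam F) (open_mean p F) (spin u) (?q\<^sup>2 + ?q)"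
    by (simp only: card.empty) (simp add: power_one_over)
  moreover have lam01: "0 \<le> lam v \<and> lam v \<le> 1" if "v \<in> V" for v
    using lam[OF that] L by simp
  then have "ising_weight V (ising V p ?lam F)" "ising_weight V (ising V p lam F)"
    using F p by (auto intro!: ising_weight_ising)
  moreover have "ising V p lam F =
      (\<lambda>M. ((1 + lam u) / 2 + (1 - lam u) / 2 * spin u M) * ising V p ?lam F M)"
    using ising_field[OF V u] by blast
  ultimately have "excess_le V (ising V p lam F) (open_mean p F) (spin u) (lam u * (?q\<^sup>2 + ?q))"
    using excess_field_step[OF V u, of "ising V p ?lam F" "lam u" "?q\<^sup>2 + ?q"] lam01[OF u] L
    by simp
  moreover have "lam u * (?q\<^sup>2 + ?q) \<le> 1 / (1 - L)\<^sup>2"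
  proof -
    have "lam u * (?q\<^sup>2 + ?q) \<le> L * (?q\<^sup>2 + ?q)"
      using lam[OF u] L by (intro mult_right_mono) auto
    also have "\<dots> = (L * ?q) * ?q + L * ?q"
      by (simp add: distrib_left power2_eq_square)
    also have "L * ?q = ?q - 1"
      using L by (simp add: field_simps)
    finally have "lam u * (?q\<^sup>2 + ?q) \<le> ?q\<^sup>2 - 1"
      by (simp add: algebra_simps power2_eq_square)
    then show ?thesis by (simp add: power_one_over)
  qed
  ultimately show ?thesis
    using excess_le_mono[OF V _ ferro_spin[OF u]] \<open>ising_weight V (ising V p lam F)\<close> by blast
qed

section \<open>Forcing the ends of an edge to agree\<close>

definition up :: "'v \<Rightarrow> 'v set \<Rightarrow> real" where
  "up v M = (1 + spin v M) / 2"

lemma up_eq: "up v M = (if v \<in> M then 0 else 1)"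
  by (simp add: up_def spin_def)

lemma ferro_up: "v \<in> V \<Longrightarrow> ferro V (up v)"
  using ferro_scale[OF _ ferro.add[OF ferro.const[of 1 V] ferro_spin], of "1 / 2" v]
  by (simp add: up_def[abs_def])

lemma agree_up: "u \<noteq> v \<Longrightarrow> agree {u, v} M * (up u M * up v M) = up u M * up v M"
  by (auto simp: agree_def up_eq)

text \<open>Weight 0 for a minus spin at \<open>v\<close> forces plus there, so the conditioned
  system is again an Ising model with fields in the same range.\<close>

lemma ising_wired:
  assumes "finite V" "v \<in> V"
  shows "ising V p (lam(v := 0)) F M = up v M * ising V p lam F M"
proof -
  have "(\<Prod>x\<in>V - {v}. if x \<in> M then (lam(v := 0)) x else 1) =
      (\<Prod>x\<in>V - {v}. if x \<in> M then lam x else 1)"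
    by (intro prod.cong) auto
  then show ?thesis
    using assms by (simp add: ising_def prod.remove[of V v] up_eq)
qed

lemma moment_up: "moment V w (\<lambda>M. f M * up v M) = (moment V w f + moment V w (\<lambda>M. f M * spin v M)) / 2"
  using moment_cmult[of V w "1 / 2" "\<lambda>M. f M + f M * spin v M"]
  by (simp add: moment_add up_def field_simps)

text \<open>The constant part of \<open>up v\<close> contributes no excess, and adding it only
  enlarges the denominator; thus a bound for the source \<open>spin v\<close> passes to conditioning
  on plus.\<close>

lemma excess_up:
  assumes "excess_le V w f (spin v) c" "0 \<le> c"
    "0 < moment V w (\<lambda>_. 1)" "0 < moment V w (up v)"
  shows "moment V w (\<lambda>M. f M * up v M) / moment V w (up v)
    - moment V w f / moment V w (\<lambda>_. 1) \<le> c"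
proof -
  let ?Z = "moment V w (\<lambda>_. 1)" and ?P = "moment V w (up v)" and ?x = "moment V w (spin v)"
  have P: "?P = (?Z + ?x) / 2"
    using moment_up[of V w "\<lambda>_. 1" v] by simp
  have "moment V w (\<lambda>M. f M * up v M) * ?Z - moment V w f * ?P =
      (moment V w (\<lambda>M. f M * spin v M) * ?Z - moment V w f * ?x) / 2"
    unfolding moment_up P by (simp add: field_simps)
  also have "\<dots> \<le> c * (?x * ?Z) / 2"
    using assms(1) by (simp add: excess_le_def)
  also have "\<dots> \<le> c * (?P * ?Z)"
  proof -
    have "?x * ?Z / 2 \<le> ?P * ?Z"
      using assms(3) unfolding P by (simp add: field_simps)
    from mult_left_mono[OF this assms(2)] show ?thesis by simp
  qed
  finally have "moment V w (\<lambda>M. f M * up v M) * ?Z - moment V w f * ?P \<le> c * (?P * ?Z)" .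
  moreover have "moment V w (\<lambda>M. f M * up v M) / ?P - moment V w f / ?Z =
      (moment V w (\<lambda>M. f M * up v M) * ?Z - moment V w f * ?P) / (?P * ?Z)"
    using assms by (simp add: field_simps)
  ultimately show ?thesis
    using assms by (simp add: pos_divide_le_eq)
qed

text \<open>Griffiths' inequality for two agreement indicators. It removes the absolute values from
  a row sum.\<close>

lemma merge_nonneg:
  assumes V: "finite V" and F: "\<And>e. e \<in> F \<Longrightarrow> e \<subseteq> V \<and> card e = 2"
    and p: "\<And>e. e \<in> F \<Longrightarrow> 0 \<le> p e \<and> p e \<le> 1"
    and lam: "\<And>v. v \<in> V \<Longrightarrow> 0 \<le> lam v \<and> lam v \<le> 1"
    and e: "e \<subseteq> V" "card e = 2" and d: "d \<subseteq> V" "card d = 2"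
    and w: "w = ising V p lam F"
  shows "moment V w (agree d) / moment V w (\<lambda>_. 1)
    \<le> moment V w (\<lambda>M. agree d M * agree e M) / moment V w (agree e)"
proof -
  have wt: "ising_weight V w"
    unfolding w using F p lam by (intro ising_weight_ising) auto
  have "0 < moment V w (\<lambda>_. 1)"
    unfolding w using V p lam by (intro ising_moment_pos) auto
  moreover have "0 < moment V w (agree e)"
  proof -
    have "0 < moment V (\<lambda>M. agree e M * w M) (\<lambda>_. 1)"
      using V p lam
      by (intro moment_one_pos)
        (auto simp: w ising_empty agree_def intro!: ising_nonneg mult_nonneg_nonneg)
    then show ?thesis by (simp add: moment_weight)
  qed
  ultimately show ?thesis
    using griffiths[OF V wt ferro_agree[OF d(2,1)] ferro_agree[OF e(2,1)]]
    by (simp add: field_simps)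
qed

lemma merge_le:
  fixes L :: real
  assumes V: "finite V" and L: "0 \<le> L" "L < 1"
    and F: "finite F" "\<And>e. e \<in> F \<Longrightarrow> e \<subseteq> V \<and> card e = 2"
    and p: "\<And>e. e \<in> F \<Longrightarrow> 0 \<le> p e \<and> p e \<le> 1"
    and lam: "\<And>v. v \<in> V \<Longrightarrow> 0 \<le> lam v \<and> lam v \<le> L"
    and e: "e \<subseteq> V" "card e = 2" and w: "w = ising V p lam F"
  shows "moment V w (\<lambda>M. open_mean p F M * agree e M) / moment V w (agree e)
    - moment V w (open_mean p F) / moment V w (\<lambda>_. 1) \<le> 2 / (1 - L)\<^sup>2"
proof -
  obtain u v where uv: "e = {u, v}" "u \<noteq> v"
    using e by (auto simp: card_2_iff)
  then have u: "u \<in> V" and v: "v \<in> V" using e by auto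
  let ?f = "open_mean p F" and ?c = "1 / (1 - L)\<^sup>2"
  let ?m = "moment V w" and ?pp = "\<lambda>M. up u M * up v M"
  \<comment> \<open>The second increase is taken in the model where \<open>u\<close> is already
    plus; its fields are still at most \<open>L\<close>, so the same vertex bound applies.\<close>
  define w' where "w' = ising V p (lam(u := 0)) F"
  have w': "w' = (\<lambda>M. up u M * w M)"
    using ising_wired[OF V u] unfolding w'_def w by blast
  have lam1: "0 \<le> lam v \<and> lam v \<le> 1" if "v \<in> V" for v using lam[OF that] L by simp
  have wt: "ising_weight V w"
    unfolding w using F p lam1 by (intro ising_weight_ising) auto
  have w0: "0 \<le> w M" for M
    unfolding w using p lam by (intro ising_nonneg) auto
  have pos: "0 < ?m h" if "h {} = 1" "\<And>M. 0 \<le> h M" for h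
  proof -
    have "0 < moment V (\<lambda>M. h M * w M) (\<lambda>_. 1)"
      using V that w0 by (intro moment_one_pos) (auto simp: w ising_empty)
    then show ?thesis by (simp add: moment_weight)
  qed
  have pos': "0 < ?m (\<lambda>_. 1)" "0 < ?m (up u)" "0 < ?m ?pp" "0 < ?m (agree e)"
    by (auto intro!: pos simp: up_eq agree_def)
  have 1: "?m (\<lambda>M. ?f M * up u M) / ?m (up u) - ?m ?f / ?m (\<lambda>_. 1) \<le> ?c"
    using pos' excess_vertex[OF V L F p lam u] by (intro excess_up) (auto simp: w)
  have "moment V w' (\<lambda>M. ?f M * up v M) / moment V w' (up v)
      - moment V w' ?f / moment V w' (\<lambda>_. 1) \<le> ?c"
  proof (intro excess_up)
    show "excess_le V w' ?f (spin v) ?c"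
      unfolding w'_def using lam L by (intro excess_vertex V F p v) auto
  qed (use pos' in \<open>auto simp: w' moment_weight\<close>)
  then have 2: "?m (\<lambda>M. ?f M * ?pp M) / ?m ?pp - ?m (\<lambda>M. ?f M * up u M) / ?m (up u) \<le> ?c"
    unfolding w' moment_weight by (simp add: mult_ac)
  have we: "ising_weight V (\<lambda>M. agree e M * w M)"
    using ising_weight.factor[OF e(1) _ _ wt, of "1 / 2" "1 / 2"] agree_chi[OF e(2)]
    by (simp add: add_divide_distrib)
  have eq: "agree e M * ?pp M = ?pp M" "agree e M * (?f M * ?pp M) = ?f M * ?pp M" for M
    using agree_up[OF uv(2), of M] uv(1) by auto
  \<comment> \<open>Griffiths' inequality in the model conditioned on agreement along
    \<open>e\<close>. Both ends plus implies agreement, so \<open>?pp\<close> absorbs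
    \<open>agree e\<close>.\<close>
  have "?m (\<lambda>M. ?f M * agree e M) * ?m ?pp \<le> ?m (\<lambda>M. ?f M * ?pp M) * ?m (agree e)"
    using griffiths[OF V we ferro_open_mean ferro_mult[OF ferro_up[OF u] ferro_up[OF v]],
        of F p] F p
    unfolding moment_weight eq by (simp add: mult.commute[of "agree e _" "?f _"])
  then have "?m (\<lambda>M. ?f M * agree e M) / ?m (agree e) \<le> ?m (\<lambda>M. ?f M * ?pp M) / ?m ?pp"
    using pos' by (simp add: field_simps)
  then show ?thesis using 1 2 by simp
qed

section \<open>From component weights to spins\<close>

lemma agree_prod:
  assumes "finite S"
  shows "(\<Prod>e\<in>S. agree e M) = (if \<forall>e\<in>S. e \<subseteq> M \<or> e \<inter> M = {} then 1 else 0)"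
  using assms by (induction S rule: finite_induct) (auto simp: agree_def)

text \<open>Expanding the product selects a set of components, which become minus. Their union
  determines the selection, and the sets so obtained are those that no edge of \<open>S\<close>
  leaves.\<close>

lemma components_sum:
  assumes V: "finite V" and S: "finite S" "\<And>e. e \<in> S \<Longrightarrow> e \<subseteq> V \<and> card e = 2"
  shows "(\<Prod>C\<in>components V S. 1 + (\<Prod>j\<in>C. lam j))
    = (\<Sum>M\<in>Pow V. (\<Prod>e\<in>S. agree e M) * (\<Prod>v\<in>V. if v \<in> M then lam v else 1 :: real))"
proof -
  define R where "R = {(u, v) \<in> V \<times> V. (u, v) \<in> (adj S)\<^sup>*}"
  have sym: "sym ((adj S)\<^sup>*)"
    by (intro sym_rtrancl) (auto simp: sym_def adj_def insert_commute)
  have "sym R"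
    by (rule symI) (auto simp: R_def intro: symD[OF sym])
  then have R: "equiv V R"
    by (auto simp: R_def equiv_def refl_on_def trans_def)
  let ?K = "V // R"
  have K: "components V S = ?K" by (simp add: components_def R_def)
  have finK: "finite ?K"
    using V R by (simp add: equiv_type finite_quotient)
  have subK: "C \<subseteq> V" if "C \<in> ?K" for C
    using that R by (auto simp: quotient_def R_def)
  \<comment> \<open>The facts \<open>closed\<close>, \<open>union\<close> and \<open>inv\<close>
    show that taking unions is a bijection from the sets of components onto
    \<open>?cl\<close>.\<close>
  let ?cl = "{M \<in> Pow V. \<forall>e\<in>S. e \<subseteq> M \<or> e \<inter> M = {}}"
  have closed: "\<Union>A \<in> ?cl" if "A \<subseteq> ?K" for A
  proof -
    have "e \<subseteq> \<Union>A" if e: "e \<in> S" "e \<inter> \<Union>A \<noteq> {}" for e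
    proof -
      obtain x y where xy: "e = {x, y}" "x \<in> \<Union>A"
        using e S(2)[OF e(1)] by (auto simp: card_2_iff doubleton_eq_iff)
      then obtain C where C: "C \<in> A" "x \<in> C" by auto
      have "(x, y) \<in> R"
        using xy e S(2)[OF e(1)] by (auto simp: R_def adj_def)
      then have "y \<in> C"
        using in_quotient_imp_closed[OF R, of C x y] C \<open>A \<subseteq> ?K\<close> by blast
      then show ?thesis using C xy by auto
    qed
    moreover have "\<Union>A \<subseteq> V" using subK that by auto
    ultimately show ?thesis by auto
  qed
  have union: "\<Union>{C \<in> ?K. C \<subseteq> M} = M" if M: "M \<in> ?cl" for M
  proof
    show "M \<subseteq> \<Union>{C \<in> ?K. C \<subseteq> M}"
    proof
      fix x assume x: "x \<in> M"
      have "y \<in> M" if "(x, y) \<in> (adj S)\<^sup>*" for y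
        using that x
      proof induction
        case (step y z)
        then have "{y, z} \<in> S" "y \<in> M" by (auto simp: adj_def)
        then show ?case using M by auto
      qed auto
      then have "R `` {x} \<subseteq> M" by (auto simp: R_def)
      moreover have "x \<in> V" using x M by auto
      then have "x \<in> R `` {x}" "R `` {x} \<in> ?K"
        by (rule equiv_class_self[OF R], rule quotientI)
      ultimately show "x \<in> \<Union>{C \<in> ?K. C \<subseteq> M}" by blast
    qed
  qed auto
  have inv: "{C \<in> ?K. C \<subseteq> \<Union>A} = A" if A: "A \<subseteq> ?K" for A
  proof
    show "{C \<in> ?K. C \<subseteq> \<Union>A} \<subseteq> A"
    proof
      fix C assume C: "C \<in> {C \<in> ?K. C \<subseteq> \<Union>A}"
      then obtain x where x: "x \<in> C"
        using R by (auto dest: in_quotient_imp_non_empty)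
      then obtain D where "D \<in> A" "x \<in> D" using C by auto
      then have "C = D" using quotient_disj[OF R, of C D] x C A by blast
      then show "C \<in> A" using \<open>D \<in> A\<close> by simp
    qed
  qed (use A in auto)
  have "(\<Prod>C\<in>?K. 1 + (\<Prod>j\<in>C. lam j)) = (\<Sum>A\<in>Pow ?K. \<Prod>C\<in>A. \<Prod>j\<in>C. lam j)"
    using prod_add[OF finK, of "\<lambda>C. \<Prod>j\<in>C. lam j" "\<lambda>_. 1"] by (simp add: add.commute)
  also have "\<dots> = (\<Sum>A\<in>Pow ?K. \<Prod>j\<in>\<Union>A. lam j)"
  proof (intro sum.cong refl)
    fix A assume A: "A \<in> Pow ?K"
    have "\<forall>C\<in>A. \<forall>D\<in>A. C \<noteq> D \<longrightarrow> C \<inter> D = {}"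
      using A quotient_disj[OF R] by blast
    moreover have "\<forall>C\<in>A. finite C"
      using A subK finite_subset[OF _ V] by blast
    ultimately show "(\<Prod>C\<in>A. \<Prod>j\<in>C. lam j) = (\<Prod>j\<in>\<Union>A. lam j)"
      by (subst prod.Union_disjoint) auto
  qed
  also have "\<dots> = (\<Sum>M\<in>?cl. \<Prod>j\<in>M. lam j)"
    by (rule sum.reindex_bij_witness[where j = Union and i = "\<lambda>M. {C \<in> ?K. C \<subseteq> M}"])
      (use closed union inv in auto)
  also have "\<dots> = (\<Sum>M\<in>?cl. (\<Prod>e\<in>S. agree e M) * (\<Prod>v\<in>V. if v \<in> M then lam v else 1))"
  proof (intro sum.cong refl)
    fix M assume M: "M \<in> ?cl"
    then have "(\<Prod>v\<in>V. if v \<in> M then lam v else 1) = (\<Prod>j\<in>M. lam j)"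
      using V by (simp add: prod.If_cases Int_absorb1)
    then show "(\<Prod>j\<in>M. lam j) = (\<Prod>e\<in>S. agree e M) * (\<Prod>v\<in>V. if v \<in> M then lam v else 1)"
      using M by (simp add: agree_prod[OF S(1)])
  qed
  also have "\<dots> = (\<Sum>M\<in>Pow V. (\<Prod>e\<in>S. agree e M) * (\<Prod>v\<in>V. if v \<in> M then lam v else 1))"
    using V by (intro sum.mono_neutral_left) (auto simp: agree_prod[OF S(1)])
  finally show ?thesis by (simp add: K)
qed

text \<open>After exchanging the sums, the edges are independent for fixed spins. General
  \<open>a\<close> and \<open>b\<close> allow a zero factor for a pinned edge.\<close>

lemma edwards_sokal:
  assumes G: "simple_graph V E"
  shows "(\<Sum>S\<in>Pow E. (\<Prod>e\<in>S. a e) * (\<Prod>e\<in>E - S. b e) * (\<Prod>C\<in>components V S. 1 + (\<Prod>j\<in>C. lam j)))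
    = (\<Sum>M\<in>Pow V. (\<Prod>e\<in>E. b e + a e * agree e M) * (\<Prod>v\<in>V. if v \<in> M then lam v else 1 :: real))"
proof -
  have E: "finite E" using simple_graph_finite_edges[OF G] .
  let ?l = "\<lambda>M. \<Prod>v\<in>V. if v \<in> M then lam v else 1"
  have "(\<Sum>S\<in>Pow E. (\<Prod>e\<in>S. a e) * (\<Prod>e\<in>E - S. b e) * (\<Prod>C\<in>components V S. 1 + (\<Prod>j\<in>C. lam j)))
      = (\<Sum>S\<in>Pow E. \<Sum>M\<in>Pow V. (\<Prod>e\<in>S. a e * agree e M) * (\<Prod>e\<in>E - S. b e) * ?l M)"
  proof (intro sum.cong refl)
    fix S assume S: "S \<in> Pow E"
    have "(\<Prod>C\<in>components V S. 1 + (\<Prod>j\<in>C. lam j)) = (\<Sum>M\<in>Pow V. (\<Prod>e\<in>S. agree e M) * ?l M)"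
      using G S finite_subset[OF _ E] by (intro components_sum) (auto simp: simple_graph_def)
    then show "(\<Prod>e\<in>S. a e) * (\<Prod>e\<in>E - S. b e) * (\<Prod>C\<in>components V S. 1 + (\<Prod>j\<in>C. lam j))
        = (\<Sum>M\<in>Pow V. (\<Prod>e\<in>S. a e * agree e M) * (\<Prod>e\<in>E - S. b e) * ?l M)"
      by (simp add: sum_distrib_left prod.distrib mult_ac)
  qed
  also have "\<dots> = (\<Sum>M\<in>Pow V. \<Sum>S\<in>Pow E. (\<Prod>e\<in>S. a e * agree e M) * (\<Prod>e\<in>E - S. b e) * ?l M)"
    by (rule sum.swap)
  also have "\<dots> = (\<Sum>M\<in>Pow V. (\<Prod>e\<in>E. a e * agree e M + b e) * ?l M)"
    unfolding prod_add[OF E] sum_distrib_right ..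
  finally show ?thesis by (simp add: add.commute)
qed

section \<open>Pinned edges\<close>

definition pinned :: "('e \<Rightarrow> real) \<Rightarrow> 'e set \<Rightarrow> 'e set \<Rightarrow> 'e \<Rightarrow> real" where
  "pinned p \<tau> \<Lambda> e = (if e \<in> \<Lambda> then if e \<in> \<tau> then 1 else 0 else p e)"

text \<open>The constant split off when the parameters of the pinned edges are replaced by 1 or
  0.\<close>

definition pin_weight :: "('e \<Rightarrow> real) \<Rightarrow> 'e set \<Rightarrow> 'e set \<Rightarrow> real" where
  "pin_weight p \<tau> \<Lambda> = (\<Prod>e\<in>\<Lambda>. if e \<in> \<tau> then p e else 1 - p e)"

text \<open>Setting \<open>a\<close> or \<open>b\<close> to 0 on the pinned edges annihilates every
  \<open>S\<close> outside the pinning, so the restricted sum extends to \<open>Pow E\<close> and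
  the coupling identity applies.\<close>

lemma sum_pinning:
  assumes G: "simple_graph V E" and \<Lambda>: "\<Lambda> \<subseteq> E"
  shows "(\<Sum>S\<in>pinning E \<tau> \<Lambda>. rc_weight V E p lam S) =
    pin_weight p \<tau> \<Lambda> * moment V (ising V (pinned p \<tau> \<Lambda>) lam E) (\<lambda>_. 1)"
proof -
  have E: "finite E" using simple_graph_finite_edges[OF G] .
  define a where "a e = (if e \<in> \<Lambda> - \<tau> then 0 else p e)" for e
  define b where "b e = (if e \<in> \<Lambda> \<inter> \<tau> then 0 else 1 - p e)" for e
  define k where "k e = (if e \<in> \<Lambda> then if e \<in> \<tau> then p e else 1 - p e else 1)" for e
  let ?c = "\<lambda>S. \<Prod>C\<in>components V S. 1 + (\<Prod>j\<in>C. lam j)"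
  have "(\<Sum>S\<in>pinning E \<tau> \<Lambda>. rc_weight V E p lam S)
      = (\<Sum>S\<in>pinning E \<tau> \<Lambda>. (\<Prod>e\<in>S. a e) * (\<Prod>e\<in>E - S. b e) * ?c S)"
  proof (intro sum.cong refl)
    fix S assume S: "S \<in> pinning E \<tau> \<Lambda>"
    have "(\<Prod>e\<in>S. a e) = (\<Prod>e\<in>S. p e)" "(\<Prod>e\<in>E - S. b e) = (\<Prod>e\<in>E - S. 1 - p e)"
      using S by (auto simp: a_def b_def pinning_def intro!: prod.cong)
    then show "rc_weight V E p lam S = (\<Prod>e\<in>S. a e) * (\<Prod>e\<in>E - S. b e) * ?c S"
      by (simp add: rc_weight_def)
  qed
  also have "\<dots> = (\<Sum>S\<in>Pow E. (\<Prod>e\<in>S. a e) * (\<Prod>e\<in>E - S. b e) * ?c S)"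
  proof (rule sum.mono_neutral_left)
    show "\<forall>S\<in>Pow E - pinning E \<tau> \<Lambda>. (\<Prod>e\<in>S. a e) * (\<Prod>e\<in>E - S. b e) * ?c S = 0"
    proof
      fix S assume S: "S \<in> Pow E - pinning E \<tau> \<Lambda>"
      then obtain e where e: "e \<in> \<Lambda>" "e \<in> S \<longleftrightarrow> e \<notin> \<tau>"
        by (auto simp: pinning_def)
      have "finite S" using S E finite_subset by auto
      show "(\<Prod>e\<in>S. a e) * (\<Prod>e\<in>E - S. b e) * ?c S = 0"
      proof (cases "e \<in> S")
        case True
        then have "(\<Prod>e\<in>S. a e) = 0"
          using e \<open>finite S\<close> by (intro prod_zero) (auto simp: a_def)
        then show ?thesis by simp
      next
        case False
        then have "(\<Prod>e\<in>E - S. b e) = 0"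
          using e E \<Lambda> by (intro prod_zero) (auto simp: b_def)
        then show ?thesis by simp
      qed
    qed
  qed (use E in \<open>auto simp: pinning_def\<close>)
  also have "\<dots> = (\<Sum>M\<in>Pow V. (\<Prod>e\<in>E. b e + a e * agree e M) *
      (\<Prod>v\<in>V. if v \<in> M then lam v else 1))"
    by (rule edwards_sokal[OF G])
  also have "\<dots> = (\<Sum>M\<in>Pow V. (\<Prod>e\<in>E. k e) * ising V (pinned p \<tau> \<Lambda>) lam E M)"
  proof (intro sum.cong refl)
    fix M
    have "b e + a e * agree e M
        = k e * (1 - pinned p \<tau> \<Lambda> e + pinned p \<tau> \<Lambda> e * agree e M)" for e
      by (simp add: a_def b_def k_def pinned_def)
    then show "(\<Prod>e\<in>E. b e + a e * agree e M) * (\<Prod>v\<in>V. if v \<in> M then lam v else 1)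
        = (\<Prod>e\<in>E. k e) * ising V (pinned p \<tau> \<Lambda>) lam E M"
      by (simp add: ising_def prod.distrib)
  qed
  also have "(\<Prod>e\<in>E. k e) = pin_weight p \<tau> \<Lambda>"
    unfolding pin_weight_def k_def using E \<Lambda> by (simp add: prod.If_cases Int_absorb1)
  finally show ?thesis
    by (simp add: moment_def sum_distrib_left)
qed

lemma prob_pinning:
  assumes G: "simple_graph V E"
    and p: "\<And>e. e \<in> E \<Longrightarrow> 0 < p e \<and> p e < 1"
    and lam: "\<And>v. v \<in> V \<Longrightarrow> 0 \<le> lam v \<and> lam v < 1" and \<Lambda>: "\<Lambda> \<subseteq> E"
  shows "measure_pmf.prob (random_cluster V E p lam) (pinning E \<tau> \<Lambda>) =
    pin_weight p \<tau> \<Lambda> * moment V (ising V (pinned p \<tau> \<Lambda>) lam E) (\<lambda>_. 1)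
      / (\<Sum>S\<in>Pow E. rc_weight V E p lam S)"
proof -
  let ?P = "pinning E \<tau> \<Lambda>"
  have "finite ?P"
    using simple_graph_finite_edges[OF G] by (simp add: pinning_def)
  then have "measure_pmf.prob (random_cluster V E p lam) ?P = (\<Sum>S\<in>?P. pmf (random_cluster V E p lam) S)"
    by (rule measure_measure_pmf_finite)
  also have "\<dots> = (\<Sum>S\<in>?P. rc_weight V E p lam S / (\<Sum>S\<in>Pow E. rc_weight V E p lam S))"
    by (intro sum.cong refl) (auto simp: pmf_random_cluster[OF G p lam] pinning_def)
  also have "\<dots> = (\<Sum>S\<in>?P. rc_weight V E p lam S) / (\<Sum>S\<in>Pow E. rc_weight V E p lam S)"
    by (simp add: sum_divide_distrib)
  finally show ?thesis by (simp add: sum_pinning[OF G \<Lambda>])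
qed

lemma ising_open:
  assumes "finite F" "e \<in> F"
  shows "ising V (p(e := 1)) lam F M = agree e M * ising V p lam F M"
proof -
  have "(\<Prod>d\<in>F - {e}. 1 - (p(e := 1)) d + (p(e := 1)) d * agree d M) =
      (\<Prod>d\<in>F - {e}. 1 - p d + p d * agree d M)"
    by (intro prod.cong) auto
  moreover have "agree e M * (1 - p e + p e * agree e M) = agree e M"
    by (simp add: agree_def)
  ultimately show ?thesis
    using assms by (simp add: ising_def prod.remove[of F e] flip: mult.assoc)
qed

lemma prob_cond_pmf:
  assumes "0 < measure_pmf.prob \<mu> P"
  shows "measure_pmf.prob (cond_pmf \<mu> P) A = measure_pmf.prob \<mu> (P \<inter> A) / measure_pmf.prob \<mu> P"
proof -
  have "set_pmf \<mu> \<inter> P \<noteq> {}"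
    using assms by (simp add: measure_pmf_zero_iff[symmetric])
  then show ?thesis
    using assms by (simp add: cond_pmf.rep_eq measure_uniform_measure emeasure_pmf measure_pmf.emeasure_eq_measure)
qed

lemma pinning_open: "pinning E \<tau> \<Lambda> \<inter> {S. i \<in> S} = pinning E (insert i \<tau>) (insert i \<Lambda>)"
  if "i \<in> E" "i \<notin> \<Lambda>"
  using that by (auto simp: pinning_def)

lemma pinning_closed: "pinning E \<tau> \<Lambda> \<inter> {S. i \<notin> S} = pinning E (\<tau> - {i}) (insert i \<Lambda>)"
  if "i \<notin> \<Lambda>"
  using that by (auto simp: pinning_def)

lemma pinned_open: "pinned p (insert i \<tau>) (insert i \<Lambda>) = (pinned p \<tau> \<Lambda>)(i := 1)"
  by (auto simp: pinned_def)

lemma pinned_closed: "pinned p (\<tau> - {i}) (insert i \<Lambda>) = (pinned p \<tau> \<Lambda>)(i := 0)"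
  by (auto simp: pinned_def)

lemma pin_weight_open:
  assumes "finite \<Lambda>" "i \<notin> \<Lambda>"
  shows "pin_weight p (insert i \<tau>) (insert i \<Lambda>) = p i * pin_weight p \<tau> \<Lambda>"
  using assms unfolding pin_weight_def by (auto intro!: prod.cong arg_cong2[where f = "(*)"])

lemma pin_weight_closed:
  assumes "finite \<Lambda>" "i \<notin> \<Lambda>"
  shows "pin_weight p (\<tau> - {i}) (insert i \<Lambda>) = (1 - p i) * pin_weight p \<tau> \<Lambda>"
  using assms unfolding pin_weight_def by (auto intro!: prod.cong arg_cong2[where f = "(*)"])

section \<open>Influences as Ising correlations\<close>

text \<open>Conditioning on \<open>i\<close> or \<open>j\<close> is a further pinning, and opening
  an edge multiplies the weight of the model with that edge closed by its agreement indicator. Both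
  conditional probabilities thus become means under the single weight \<open>w\<close>; the pinning
  constants cancel.\<close>

lemma influence_pinned:
  assumes G: "simple_graph V E"
    and p: "\<And>e. e \<in> E \<Longrightarrow> 0 < p e \<and> p e < 1"
    and lam: "\<And>v. v \<in> V \<Longrightarrow> 0 \<le> lam v \<and> lam v < 1" and \<Lambda>: "\<Lambda> \<subseteq> E"
    and pos: "0 < measure_pmf.prob (random_cluster V E p lam) (pinning E \<tau> \<Lambda>)"
    and \<nu>: "\<nu> = map_pmf (\<lambda>S. S \<inter> (E - \<Lambda>)) (cond_pmf (random_cluster V E p lam) (pinning E \<tau> \<Lambda>))"
    and p': "p' = (pinned p \<tau> \<Lambda>)(i := 0)" and w: "w = ising V p' lam E"
    and ij: "i \<in> E - \<Lambda>" "j \<in> E - \<Lambda>" "i \<noteq> j"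
  shows "\<P>(S in \<nu>. j \<in> S \<bar> i \<in> S) =
      p j * (moment V w (\<lambda>M. agree j M * agree i M) / moment V w (agree i))"
    and "\<P>(S in \<nu>. j \<in> S \<bar> i \<notin> S) = p j * (moment V w (agree j) / moment V w (\<lambda>_. 1))"
proof -
  let ?\<mu> = "random_cluster V E p lam" and ?P = "pinning E \<tau> \<Lambda>"
  let ?Z = "\<Sum>S\<in>Pow E. rc_weight V E p lam S" and ?k = "pin_weight p \<tau> \<Lambda>"
  let ?D = "measure_pmf.prob ?\<mu> ?P"
  have E: "finite E" using simple_graph_finite_edges[OF G] .
  have fin: "finite \<Lambda>" using E \<Lambda> finite_subset by blast
  have ppin: "measure_pmf.prob ?\<mu> (pinning E \<tau> \<Lambda>) =
      pin_weight p \<tau> \<Lambda> * moment V (ising V (pinned p \<tau> \<Lambda>) lam E) (\<lambda>_. 1) / ?Z"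
    if "\<Lambda> \<subseteq> E" for \<tau> \<Lambda>
    by (intro prob_pinning G p lam that)
  have nz: "?Z \<noteq> 0" "?k \<noteq> 0"
    using pos ppin[OF \<Lambda>, of \<tau>] by auto
  have pi: "p i \<noteq> 0" "1 - p i \<noteq> 0" using p[of i] ij by auto
  have nu: "measure_pmf.prob \<nu> {S. Q S} = measure_pmf.prob ?\<mu> (?P \<inter> {S. Q (S \<inter> (E - \<Lambda>))}) / ?D" for Q
    unfolding \<nu> measure_map_pmf prob_cond_pmf[OF pos] by (simp add: vimage_def)
  have wi: "ising V ((pinned p \<tau> \<Lambda>)(i := 1)) lam E = (\<lambda>M. agree i M * w M)"
    using ising_open[OF E, of i V p' lam] ij unfolding w p' by auto
  have wj: "ising V (p'(j := 1)) lam E = (\<lambda>M. agree j M * w M)"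
    using ising_open[OF E, of j V p' lam] ij unfolding w by auto
  have wij: "ising V ((pinned p \<tau> \<Lambda>)(i := 1, j := 1)) lam E = (\<lambda>M. agree j M * (agree i M * w M))"
    using ising_open[OF E, of j V "(pinned p \<tau> \<Lambda>)(i := 1)" lam] ij unfolding wi by auto
  have mij: "moment V (\<lambda>M. agree j M * (agree i M * w M)) (\<lambda>_. 1) =
      moment V w (\<lambda>M. agree j M * agree i M)"
    by (simp add: moment_def mult_ac)
  have "?P \<inter> {S. i \<in> S \<inter> (E - \<Lambda>)} = ?P \<inter> {S. i \<in> S}"
    "?P \<inter> {S. i \<notin> S \<inter> (E - \<Lambda>)} = ?P \<inter> {S. i \<notin> S}"
    "?P \<inter> {S. j \<in> S \<inter> (E - \<Lambda>) \<and> i \<in> S \<inter> (E - \<Lambda>)} = ?P \<inter> {S. i \<in> S} \<inter> {S. j \<in> S}"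
    "?P \<inter> {S. j \<in> S \<inter> (E - \<Lambda>) \<and> i \<notin> S \<inter> (E - \<Lambda>)} = ?P \<inter> {S. i \<notin> S} \<inter> {S. j \<in> S}"
    using ij by auto
  note sets = this
  have nu_i: "measure_pmf.prob \<nu> {S. i \<in> S} = p i * ?k * moment V w (agree i) / ?Z / ?D"
    unfolding nu[of "\<lambda>S. i \<in> S"] sets
    using ij \<Lambda> fin
    by (simp add: pinning_open ppin pinned_open pin_weight_open wi moment_weight)
  have nu_ni: "measure_pmf.prob \<nu> {S. i \<notin> S} = (1 - p i) * ?k * moment V w (\<lambda>_. 1) / ?Z / ?D"
    unfolding nu[of "\<lambda>S. i \<notin> S"] sets
    using ij \<Lambda> fin
    by (simp add: pinning_closed ppin pinned_closed pin_weight_closed w p')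
  have nu_ij: "measure_pmf.prob \<nu> {S. j \<in> S \<and> i \<in> S} =
      p j * (p i * ?k) * moment V w (\<lambda>M. agree j M * agree i M) / ?Z / ?D"
    unfolding nu[of "\<lambda>S. j \<in> S \<and> i \<in> S"] sets
    using ij \<Lambda> fin
    by (simp add: pinning_open ppin pinned_open pin_weight_open wij mij)
  have nu_nij: "measure_pmf.prob \<nu> {S. j \<in> S \<and> i \<notin> S} =
      p j * ((1 - p i) * ?k) * moment V w (agree j) / ?Z / ?D"
    unfolding nu[of "\<lambda>S. j \<in> S \<and> i \<notin> S"] sets
    using ij \<Lambda> fin
    by (simp add: pinning_closed pinning_open ppin pinned_closed pinned_open pin_weight_closed
        pin_weight_open p'[symmetric] wj moment_weight)
  show "\<P>(S in \<nu>. j \<in> S \<bar> i \<in> S) =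
      p j * (moment V w (\<lambda>M. agree j M * agree i M) / moment V w (agree i))"
    unfolding cond_prob_def using nz pi pos by (simp add: nu_i nu_ij)
  show "\<P>(S in \<nu>. j \<in> S \<bar> i \<notin> S) = p j * (moment V w (agree j) / moment V w (\<lambda>_. 1))"
    unfolding cond_prob_def using nz pi pos by (simp add: nu_ni nu_nij)
qed

theorem lemma3p6:
  fixes V :: "'v set" and E :: "'v set set"
    and p :: "'v set \<Rightarrow> real" and lam :: "'v \<Rightarrow> real"
  assumes "simple_graph V E"
    and "\<And>e. e \<in> E \<Longrightarrow> 0 < p e \<and> p e < 1"
    and "\<And>v. v \<in> V \<Longrightarrow> 0 \<le> lam v \<and> lam v < 1"
  shows "spectrally_independent_all_pinnings E (random_cluster V E p lam)
           (2 * (1 - Max (lam ` V)) powi (-2))"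
  unfolding spectrally_independent_all_pinnings_def spectrally_independent_def
proof (intro allI impI)
  fix \<tau> \<Lambda> assume \<Lambda>: "\<Lambda> \<subseteq> E"
    and pos: "0 < measure_pmf.prob (random_cluster V E p lam) (pinning E \<tau> \<Lambda>)"
  define L where "L = Max (lam ` V)"
  define \<nu> where "\<nu> = map_pmf (\<lambda>S. S \<inter> (E - \<Lambda>))
    (cond_pmf (random_cluster V E p lam) (pinning E \<tau> \<Lambda>))"
  have finV: "finite V"
    using assms(1) by (simp add: simple_graph_def)
  have edge: "e \<subseteq> V" "card e = 2" if "e \<in> E" for e
    using assms(1) that by (auto simp: simple_graph_def)
  have E: "finite E" using simple_graph_finite_edges[OF assms(1)] .
  have C: "2 * (1 - L) powi (-2) = 2 / (1 - L)\<^sup>2"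
    by (simp add: power_int_minus divide_inverse)
  have row: "(\<Sum>j\<in>E - \<Lambda>. \<bar>influence \<nu> i j\<bar>) \<le> 2 / (1 - L)\<^sup>2" if i: "i \<in> E - \<Lambda>" for i
  proof -
    have iV: "i \<subseteq> V" "card i = 2" using edge i by auto
    \<comment> \<open>The edge \<open>i\<close> supplies a vertex, so \<open>Max\<close> is taken
      over a nonempty set and is attained; this yields \<open>L < 1\<close>.\<close>
    then have "V \<noteq> {}" by auto
    then have "L \<in> lam ` V" using finV by (simp add: L_def)
    then have L: "0 \<le> L" "L < 1" using assms(3) by auto
    have lam: "0 \<le> lam v \<and> lam v \<le> L" if "v \<in> V" for v
      using assms(3)[OF that] finV that by (simp add: L_def)
    \<comment> \<open>Closing \<open>i\<close> gives the reference model of the row, and its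
      parameter 0 makes the diagonal term vanish.\<close>
    define p' where "p' = (pinned p \<tau> \<Lambda>)(i := 0)"
    define w where "w = ising V p' lam E"
    have p': "0 \<le> p' e \<and> p' e \<le> 1" if "e \<in> E" for e
      using assms(2)[OF that] by (simp add: p'_def pinned_def)
    let ?d = "\<lambda>j. moment V w (\<lambda>M. agree j M * agree i M) / moment V w (agree i)
      - moment V w (agree j) / moment V w (\<lambda>_. 1)"
    have d: "0 \<le> p' j * ?d j" if "j \<in> E" for j
      using merge_nonneg[OF finV _ p' _ iV edge[OF that] w_def] edge p'[OF that] lam L
      by (intro mult_nonneg_nonneg) (auto, force+)
    have "\<bar>influence \<nu> i j\<bar> \<le> p' j * ?d j" if "j \<in> E - \<Lambda>" for j
    proof (cases "i = j")
      case True
      then show ?thesis by (simp add: influence_def p'_def)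
    next
      case False
      have infl: "\<P>(S in \<nu>. j \<in> S \<bar> i \<in> S) =
          p j * (moment V w (\<lambda>M. agree j M * agree i M) / moment V w (agree i))"
        "\<P>(S in \<nu>. j \<in> S \<bar> i \<notin> S) = p j * (moment V w (agree j) / moment V w (\<lambda>_. 1))"
        by (intro influence_pinned(1)[OF assms(1) _ _ \<Lambda> pos \<nu>_def p'_def w_def i that False]
            influence_pinned(2)[OF assms(1) _ _ \<Lambda> pos \<nu>_def p'_def w_def i that False] assms;
          assumption)+
      have "p' j = p j" using False that by (simp add: p'_def pinned_def)
      \<comment> \<open>The second alternative is the default value of \<open>influence\<close> for
        a degenerate marginal.\<close>
      then have "influence \<nu> i j = p' j * ?d j \<or> influence \<nu> i j = 0"
        unfolding influence_def infl by (simp add: right_diff_distrib)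
      then show ?thesis using d[of j] that by auto
    qed
    then have "(\<Sum>j\<in>E - \<Lambda>. \<bar>influence \<nu> i j\<bar>) \<le> (\<Sum>j\<in>E - \<Lambda>. p' j * ?d j)"
      by (rule sum_mono)
    \<comment> \<open>Adding the nonnegative terms of the pinned edges completes the sum to the full
      open mean.\<close>
    also have "\<dots> \<le> (\<Sum>j\<in>E. p' j * ?d j)"
      using E d by (intro sum_mono2) auto
    also have "\<dots> = moment V w (\<lambda>M. open_mean p' E M * agree i M) / moment V w (agree i)
        - moment V w (open_mean p' E) / moment V w (\<lambda>_. 1)"
    proof -
      have lin: "moment V w (\<lambda>M. \<Sum>j\<in>E. p' j * h j M) = (\<Sum>j\<in>E. p' j * moment V w (h j))" for h
        unfolding moment_def sum_distrib_left
        by (subst sum.swap) (simp add: mult_ac)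
      show ?thesis
        unfolding open_mean_def[abs_def] sum_distrib_right mult.assoc lin
        by (simp add: right_diff_distrib sum_subtractf sum_divide_distrib)
    qed
    also have "\<dots> \<le> 2 / (1 - L)\<^sup>2"
      using edge p' lam by (intro merge_le[OF finV L E _ _ _ iV w_def]) auto
    finally show ?thesis .
  qed
  show "matrix_infnorm (E - \<Lambda>) (influence (map_pmf (\<lambda>S. S \<inter> (E - \<Lambda>))
      (cond_pmf (random_cluster V E p lam) (pinning E \<tau> \<Lambda>)))) \<le> 2 * (1 - Max (lam ` V)) powi (-2)"
    unfolding \<nu>_def[symmetric] L_def[symmetric] C matrix_infnorm_def
    using E row by auto
qed

end
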